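(* Assume $C\subset\mathbb{P}^2$ is a rational curve of degree $d\ge 2$ with splitting type $(a,b)$, $a\le b$, which is given by parametric equations $x_i=\varphi_i(s,t)$, $i=0,1,2$. If $\sigma(\varphi)$ denotes the saturation degree of the ideal $(\varphi_0,\varphi_1,\varphi_2)\subset K[s,t]$, then $$b+d-1=\sigma(\varphi)\le 2d-2.$$
   Context: Work over an algebraically closed field $K$. Let $S=K[s,t]$ be the homogeneous coordinate ring of $\mathbb{P}^1$. A rational curve $C\subset\mathbb{P}^2$ of degree $d$ is given parametrically by three homogeneous polynomials $\varphi_0,\varphi_1,\varphi_2\in S$ of degree $d$ with no common factor, such that the morphism $\varphi=(\varphi_0,\varphi_1,\varphi_2):\mathbb{P}^1\to\mathbb{P}^2$ is generically injective and generically smooth over its image (i.e. birational onto its image) and $C=\varphi(\mathbb{P}^1)$. Splitting type: $\varphi^*\Omega_{\mathbb{P}^2}(1)\cong\mathcal{O}_{\mathbb{P}^1}(-a)\oplus\mathcal{O}_{\mathbb{P}^1}(-b)$ with $0\le a\le b$ and $a+b=d$; the pair $(a,b)$ is the splitting type of $C$. Saturation degree: the saturation $\mathrm{sat}(J)$ of a homogeneous ideal $J\subseteq(s,t)\subset S$ is the largest homogeneous ideal $\mathrm{sat}(J)\subseteq(s,t)$ such that for some $i\ge1$, $\mathrm{sat}(J)\cap(s,t)^i=J\cap(s,t)^i$. The least such $i$ is the saturation degree of $J$. *)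

theory Defs
  imports
    "HOL-Computational_Algebra.Computational_Algebra"
    "HOL-Library.Numeral_Type"
begin

section \<open>Polynomials in two and three variables\<close>

text \<open>
  The ring \<open>K[s,t]\<close> is \<open>'a poly poly\<close>, with \<open>t\<close> the outer and \<open>s\<close> the inner variable.
  The ring \<open>K[x0,x1,x2]\<close> is \<open>'a poly poly poly\<close>, with \<open>x2\<close> outermost and \<open>x0\<close> innermost.
  Triples are functions on the three-element type \<open>3\<close>, whose elements are \<open>0, 1, 2\<close>.
\<close>

definition var_s :: "'a::comm_ring_1 poly poly" where
  "var_s = [:[:0, 1:]:]"

definition var_t :: "'a::comm_ring_1 poly poly" where
  "var_t = [:0, 1:]"

definition eval2 :: "'a::comm_ring_1 poly poly \<Rightarrow> 'a \<times> 'a \<Rightarrow> 'a" where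
  "eval2 f p = poly (poly f [:snd p:]) (fst p)"

definition eval3 :: "'a::comm_ring_1 poly poly poly \<Rightarrow> (3 \<Rightarrow> 'a) \<Rightarrow> 'a" where
  "eval3 F x = poly (poly (poly F [:[:x 2:]:]) [:x 1:]) (x 0)"

definition homogeneous :: "nat \<Rightarrow> 'a::comm_ring_1 poly poly \<Rightarrow> bool" where
  "homogeneous n f \<longleftrightarrow> (\<forall>i j. coeff (coeff f j) i \<noteq> 0 \<longrightarrow> i + j = n)"

definition partial_s :: "'a::idom poly poly \<Rightarrow> 'a poly poly" where
  "partial_s = map_poly pderiv"

definition partial_t :: "'a::idom poly poly \<Rightarrow> 'a poly poly" where
  "partial_t = pderiv"

definition partial3 :: "3 \<Rightarrow> 'a::idom poly poly poly \<Rightarrow> 'a poly poly poly" where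
  "partial3 i = (if i = 0 then map_poly (map_poly pderiv)
                 else if i = 1 then map_poly pderiv else pderiv)"


section \<open>The projective line, its Zariski topology, and the sheaves \<open>\<O>(n)\<close>\<close>

text \<open>
  Subsets of a projective space are given by the sets of all homogeneous coordinate vectors of
  their points; these sets are stable under nonzero scaling and do not contain the zero vector.
\<close>

definition line_cone :: "('a::zero \<times> 'a) set" where
  "line_cone = UNIV - {(0, 0)}"

definition same_point2 :: "'a::field \<times> 'a \<Rightarrow> 'a \<times> 'a \<Rightarrow> bool" where
  "same_point2 p q \<longleftrightarrow> (\<exists>c. c \<noteq> 0 \<and> q = (c * fst p, c * snd p))"

definition same_point3 :: "(3 \<Rightarrow> 'a::field) \<Rightarrow> (3 \<Rightarrow> 'a) \<Rightarrow> bool" where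
  "same_point3 x y \<longleftrightarrow> (\<exists>c. c \<noteq> 0 \<and> (\<forall>i. y i = c * x i))"

definition zariski_open :: "('a::field \<times> 'a) set \<Rightarrow> bool" where
  "zariski_open U \<longleftrightarrow>
     (\<exists>T. (\<forall>f\<in>T. \<exists>n. homogeneous n f) \<and> U = {p \<in> line_cone. \<exists>f\<in>T. eval2 f p \<noteq> 0})"

text \<open>
  Sections of \<open>\<O>(n)\<close> over \<open>U\<close>: functions on the cone over \<open>U\<close> that are locally quotients of
  forms whose degrees differ by \<open>n\<close>. They are set to zero outside \<open>U\<close>, so that a section is
  determined by its values on \<open>U\<close>. For \<open>n = 0\<close> these are the regular functions on \<open>U\<close>.
\<close>

definition twist :: "int \<Rightarrow> ('a::field \<times> 'a) set \<Rightarrow> ('a \<times> 'a \<Rightarrow> 'a) set" where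
  "twist n U = {h. (\<forall>p. p \<notin> U \<longrightarrow> h p = 0) \<and>
     (\<forall>p\<in>U. \<exists>V f g m k. zariski_open V \<and> p \<in> V \<and> V \<subseteq> U \<and>
        homogeneous m f \<and> homogeneous k g \<and> int m - int k = n \<and>
        (\<forall>q\<in>V. eval2 g q \<noteq> 0 \<and> h q = eval2 f q / eval2 g q))}"


section \<open>Isomorphism of sheaves of modules on the projective line\<close>

text \<open>
  The sheaves below have as sections families of functions on the line, indexed by a type
  \<open>'i\<close> and vanishing outside the open set in question. The module structure over the regular
  functions is pointwise, and restriction to \<open>V\<close> truncates to \<open>V\<close>.
\<close>

type_synonym ('i, 'a) presheaf = "('a \<times> 'a) set \<Rightarrow> ('i \<Rightarrow> 'a \<times> 'a \<Rightarrow> 'a) set"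

definition restr :: "('a::field \<times> 'a) set \<Rightarrow> ('i \<Rightarrow> 'a \<times> 'a \<Rightarrow> 'a) \<Rightarrow> 'i \<Rightarrow> 'a \<times> 'a \<Rightarrow> 'a" where
  "restr V x = (\<lambda>i p. if p \<in> V then x i p else 0)"

definition sheaf_isomorphism ::
  "('i, 'a::field) presheaf \<Rightarrow> ('j, 'a) presheaf \<Rightarrow>
   (('a \<times> 'a) set \<Rightarrow> ('i \<Rightarrow> 'a \<times> 'a \<Rightarrow> 'a) \<Rightarrow> ('j \<Rightarrow> 'a \<times> 'a \<Rightarrow> 'a)) \<Rightarrow> bool" where
  "sheaf_isomorphism E F \<Phi> \<longleftrightarrow>
     (\<forall>U. zariski_open U \<longrightarrow>
        bij_betw (\<Phi> U) (E U) (F U) \<and>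
        (\<forall>x\<in>E U. \<forall>y\<in>E U.
           \<Phi> U (\<lambda>i p. x i p + y i p) = (\<lambda>j p. \<Phi> U x j p + \<Phi> U y j p)) \<and>
        (\<forall>h\<in>twist 0 U. \<forall>x\<in>E U.
           \<Phi> U (\<lambda>i p. h p * x i p) = (\<lambda>j p. h p * \<Phi> U x j p)) \<and>
        (\<forall>V x. zariski_open V \<and> V \<subseteq> U \<and> x \<in> E U \<longrightarrow>
           \<Phi> V (restr V x) = restr V (\<Phi> U x)))"

definition sheaf_isomorphic :: "('i, 'a::field) presheaf \<Rightarrow> ('j, 'a) presheaf \<Rightarrow> bool" where
  "sheaf_isomorphic E F \<longleftrightarrow> (\<exists>\<Phi>. sheaf_isomorphism E F \<Phi>)"

definition twist_sum :: "int \<Rightarrow> int \<Rightarrow> (bool, 'a::field) presheaf" where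
  "twist_sum m n U = {x. x False \<in> twist m U \<and> x True \<in> twist n U}"


section \<open>The pullback of the twisted cotangent sheaf of the plane\<close>

text \<open>
  On the chart \<open>x i \<noteq> 0\<close> of the plane the cotangent sheaf is free on the differentials
  \<open>d(x k / x i)\<close> with \<open>k \<noteq> i\<close>. Writing \<open>v k = x k / x j\<close>, the quotient rule
  \<open>d(v k / v i) = d(v k) / v i - v k * d(v i) / (v i)^2\<close> together with \<open>d(v j) = 0\<close> gives the
  coefficient of \<open>d(x l / x j)\<close>, for \<open>l \<noteq> j\<close>, in \<open>d(x k / x i)\<close>:
\<close>

definition cotangent_transition :: "3 \<Rightarrow> 3 \<Rightarrow> 3 \<Rightarrow> 3 \<Rightarrow> (3 \<Rightarrow> 'a::field) \<Rightarrow> 'a" where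
  "cotangent_transition i j k l x =
     (if l = k then x j / x i else 0) - (if l = i then x k * x j / (x i)^2 else 0)"

text \<open>
  \<open>\<O>(1)\<close> is free on the coordinate \<open>x i\<close> over the same chart, and \<open>x i = (x i / x j) * x j\<close>.
  The following is therefore the coefficient of \<open>x j \<otimes> d(x l / x j)\<close> in \<open>x i \<otimes> d(x k / x i)\<close>,
  that is, the transition matrix of \<open>\<Omega>(1)\<close> on the plane.
\<close>

definition twisted_cotangent_transition ::
  "3 \<Rightarrow> 3 \<Rightarrow> 3 \<Rightarrow> 3 \<Rightarrow> (3 \<Rightarrow> 'a::field) \<Rightarrow> 'a" where
  "twisted_cotangent_transition i j k l x = (x i / x j) * cotangent_transition i j k l x"

definition param_map :: "(3 \<Rightarrow> 'a::field poly poly) \<Rightarrow> 'a \<times> 'a \<Rightarrow> (3 \<Rightarrow> 'a)" where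
  "param_map \<phi> p = (\<lambda>i. eval2 (\<phi> i) p)"

text \<open>
  The pullback of a locally free sheaf is obtained by gluing along the preimages of the charts
  with the pulled back transition matrices. A section \<open>w\<close> has on the preimage of the chart
  \<open>x i \<noteq> 0\<close> the coefficient \<open>w (i, k)\<close> at \<open>x i \<otimes> d(x k / x i)\<close>; the unused coefficients
  \<open>w (i, i)\<close> are zero.
\<close>

definition pullback_twisted_cotangent ::
  "(3 \<Rightarrow> 'a::field poly poly) \<Rightarrow> (3 \<times> 3, 'a) presheaf" where
  "pullback_twisted_cotangent \<phi> U = {w.
     (\<forall>i. w (i, i) = (\<lambda>p. 0)) \<and>
     (\<forall>i k. k \<noteq> i \<longrightarrow> w (i, k) \<in> twist 0 {p \<in> U. param_map \<phi> p i \<noteq> 0}) \<and>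
     (\<forall>i j l. \<forall>p\<in>U. l \<noteq> j \<and> param_map \<phi> p i \<noteq> 0 \<and> param_map \<phi> p j \<noteq> 0 \<longrightarrow>
        w (j, l) p =
          (\<Sum>k\<in>UNIV - {i}. twisted_cotangent_transition i j k l (param_map \<phi> p) * w (i, k) p))}"

definition splitting_type :: "nat \<Rightarrow> (3 \<Rightarrow> 'a::field poly poly) \<Rightarrow> nat \<Rightarrow> nat \<Rightarrow> bool" where
  "splitting_type d \<phi> a b \<longleftrightarrow> a \<le> b \<and> a + b = d \<and>
     sheaf_isomorphic (pullback_twisted_cotangent \<phi>) (twist_sum (- int a) (- int b))"


section \<open>Parametrized rational plane curves\<close>

definition curve_cone :: "(3 \<Rightarrow> 'a::field poly poly) \<Rightarrow> (3 \<Rightarrow> 'a) set" where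
  "curve_cone \<phi> = {x. \<exists>p\<in>line_cone. same_point3 (param_map \<phi> p) x}"

text \<open>
  The Zariski tangent space at \<open>x\<close> of the affine cone over a set of points of the plane. Modulo
  the multiples of \<open>x\<close> it is the tangent space of the projective set at the point \<open>x\<close>.
\<close>

definition cone_tangent :: "(3 \<Rightarrow> 'a::field) set \<Rightarrow> (3 \<Rightarrow> 'a) \<Rightarrow> (3 \<Rightarrow> 'a) set" where
  "cone_tangent X x = {v. \<forall>F. (\<forall>y\<in>X. eval3 F y = 0) \<longrightarrow>
     (\<Sum>i\<in>UNIV. eval3 (partial3 i F) x * v i) = 0}"

definition param_differential ::
  "(3 \<Rightarrow> 'a::field poly poly) \<Rightarrow> 'a \<times> 'a \<Rightarrow> 'a \<times> 'a \<Rightarrow> (3 \<Rightarrow> 'a)" where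
  "param_differential \<phi> p u =
     (\<lambda>i. eval2 (partial_s (\<phi> i)) p * fst u + eval2 (partial_t (\<phi> i)) p * snd u)"

text \<open>
  Smoothness at \<open>p\<close> of the map from the line onto the curve: the differential maps the tangent
  space of the line at \<open>p\<close> onto the tangent space of the curve at the image point. As the line
  is one-dimensional, this forces the curve to be smooth at that point whenever its dimension
  is one.
\<close>

definition smooth_onto_image_at :: "(3 \<Rightarrow> 'a::field poly poly) \<Rightarrow> 'a \<times> 'a \<Rightarrow> bool" where
  "smooth_onto_image_at \<phi> p \<longleftrightarrow>
     (\<forall>v \<in> cone_tangent (curve_cone \<phi>) (param_map \<phi> p).
        \<exists>u c. v = (\<lambda>i. param_differential \<phi> p u i + c * param_map \<phi> p i))"

text \<open>A property holds generically on the line if it holds on a nonempty open subset.\<close>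

definition generically_injective :: "(3 \<Rightarrow> 'a::field poly poly) \<Rightarrow> bool" where
  "generically_injective \<phi> \<longleftrightarrow> (\<exists>U. zariski_open U \<and> U \<noteq> {} \<and>
     (\<forall>p\<in>U. \<forall>q\<in>U. same_point3 (param_map \<phi> p) (param_map \<phi> q) \<longrightarrow> same_point2 p q))"

definition generically_smooth :: "(3 \<Rightarrow> 'a::field poly poly) \<Rightarrow> bool" where
  "generically_smooth \<phi> \<longleftrightarrow>
     (\<exists>U. zariski_open U \<and> U \<noteq> {} \<and> (\<forall>p\<in>U. smooth_onto_image_at \<phi> p))"

definition rational_curve :: "nat \<Rightarrow> (3 \<Rightarrow> 'a::field poly poly) \<Rightarrow> bool" where
  "rational_curve d \<phi> \<longleftrightarrow>
     (\<forall>i. homogeneous d (\<phi> i)) \<and>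
     (\<forall>g. (\<forall>i. g dvd \<phi> i) \<longrightarrow> is_unit g) \<and>
     generically_injective \<phi> \<and> generically_smooth \<phi>"


section \<open>Ideals and the saturation degree\<close>

definition ideal_generated :: "'a::comm_ring_1 set \<Rightarrow> 'a set" where
  "ideal_generated G = module.span (*) G"

definition ideal_power :: "'a::comm_ring_1 set \<Rightarrow> nat \<Rightarrow> 'a set" where
  "ideal_power I n = ideal_generated {\<Prod>k<n. f k |f. \<forall>k<n. f k \<in> I}"

definition homogeneous_ideal :: "'a::comm_ring_1 poly poly set \<Rightarrow> bool" where
  "homogeneous_ideal I \<longleftrightarrow> (\<exists>G. (\<forall>g\<in>G. \<exists>n. homogeneous n g) \<and> I = ideal_generated G)"

definition irrelevant_ideal :: "'a::comm_ring_1 poly poly set" where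
  "irrelevant_ideal = ideal_generated {var_s, var_t}"

definition agrees_from :: "nat \<Rightarrow> 'a::comm_ring_1 poly poly set \<Rightarrow> 'a poly poly set \<Rightarrow> bool" where
  "agrees_from i I J \<longleftrightarrow>
     I \<inter> ideal_power irrelevant_ideal i = J \<inter> ideal_power irrelevant_ideal i"

definition saturation :: "'a::comm_ring_1 poly poly set \<Rightarrow> 'a poly poly set" where
  "saturation J = (GREATEST I. homogeneous_ideal I \<and> I \<subseteq> irrelevant_ideal \<and>
                     (\<exists>i\<ge>1. agrees_from i I J))"

definition saturation_degree :: "'a::comm_ring_1 poly poly set \<Rightarrow> nat" where
  "saturation_degree J = (LEAST i. i \<ge> 1 \<and> agrees_from i (saturation J) J)"

end

theory Submission
  imports Defs
begin

text \<open>
  By the Euler sequence the sections of \<open>\<phi>\<^sup>*\<Omega>(1)\<close> are the vectors of functions annihilated by \<open>\<phi>\<close>,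
  so a splitting of type \<open>(a, b)\<close> amounts to syzygies \<open>P\<close>, \<open>Q\<close> of \<open>\<phi>\<close> of degrees \<open>a\<close>, \<open>b\<close> that are
  linearly independent at every point; independence at \<open>(0, 1)\<close> suffices below. As \<open>\<phi>\<close> has no
  common zero, the saturation of \<open>J = (\<phi>\<^sub>0, \<phi>\<^sub>1, \<phi>\<^sub>2)\<close> is \<open>(s, t)\<close> and \<open>\<sigma>\<close> is the least \<open>i\<close> with
  \<open>(s, t)\<^sup>i \<subseteq> J\<close>. Some power of \<open>s\<close> lies in \<open>J\<close>. If \<open>s h = r \<cdot> \<phi>\<close> with \<open>deg h \<ge> b + d - 1\<close>, then
  \<open>r (0, 1)\<close> is a combination of \<open>P (0, 1)\<close> and \<open>Q (0, 1)\<close>, and subtracting the corresponding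
  multiples of \<open>P\<close> and \<open>Q\<close> makes \<open>r\<close> divisible by \<open>s\<close>, so \<open>h \<in> J\<close>. In degree \<open>b + d - 2\<close> the form
  \<open>t\<^bsup>b-1\<^esup> Q(0, 1) \<cdot> \<phi> / s\<close> is not in \<open>J\<close>: otherwise there is a syzygy \<open>W\<close> of degree \<open>b - 1\<close> with
  \<open>W (0, 1) = Q (0, 1)\<close>, and \<open>W \<times> P\<close> is nonzero, parallel to \<open>\<phi>\<close> and of smaller degree.

  The inequality says \<open>a > 0\<close>. If \<open>a = 0\<close> the curve is a line \<open>L\<close>, and a generic point \<open>p\<close> is the only
  zero of the form \<open>g\<close> of degree \<open>d \<ge> 2\<close> obtained by pulling back an equation of \<open>\<phi> p\<close> on \<open>L\<close>.
  Then \<open>p\<close> is a multiple zero, so the differential of \<open>\<phi>\<close> is not onto the tangent space at \<open>p\<close>.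
\<close>

section \<open>Forms in two variables\<close>

text \<open>Euclid's argument: over a finite field the product of all \<open>[:-x, 1:]\<close>
  vanishes everywhere, so adding 1 leaves a nonconstant polynomial without a root.\<close>

lemma infinite_UNIV_alg_closed: "infinite (UNIV :: 'a::alg_closed_field set)"
proof
  assume fin: "finite (UNIV :: 'a set)"
  define p where "p = (\<Prod>x\<in>(UNIV :: 'a set). [:-x, 1:])"
  have p0: "p \<noteq> 0" unfolding p_def using fin by simp
  have root: "poly p x = 0" for x
    unfolding p_def poly_prod using fin by (intro prod_zero) auto
  have "degree p \<noteq> 0"
  proof
    assume "degree p = 0"
    then obtain c where "p = [:c:]" by (meson degree_eq_zeroE)
    with root p0 show False by simp
  qed
  moreover have "degree (p + 1) = degree p"
    using \<open>degree p \<noteq> 0\<close> by (intro degree_add_eq_left) simp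
  ultimately obtain x where "poly (p + 1) x = 0"
    using alg_closed_imp_poly_has_root[of "p + 1"] by auto
  with root show False by simp
qed

lemma poly_eqI_infinite:
  fixes p q :: "'a::idom poly"
  assumes "infinite {x. poly p x = poly q x}"
  shows "p = q"
proof -
  have "{x. poly p x = poly q x} = {x. poly (p - q) x = 0}" by simp
  with assms have "infinite {x. poly (p - q) x = 0}" by metis
  then have "p - q = 0" using poly_roots_finite by blast
  then show ?thesis by simp
qed

lemma poly_ext_alg_closed:
  fixes p q :: "'a::alg_closed_field poly"
  assumes "\<And>x. poly p x = poly q x"
  shows "p = q"
  using assms infinite_UNIV_alg_closed by (intro poly_eqI_infinite) simp

lemma eval2_add: "eval2 (f + g) p = eval2 f p + eval2 g p"
  and eval2_diff: "eval2 (f - g) p = eval2 f p - eval2 g p"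
  and eval2_uminus: "eval2 (- f) p = - eval2 f p"
  and eval2_mult: "eval2 (f * g) p = eval2 f p * eval2 g p"
  and eval2_power: "eval2 (f ^ n) p = eval2 f p ^ n"
  and eval2_sum: "eval2 (sum F A) p = (\<Sum>x\<in>A. eval2 (F x) p)"
  and eval2_prod: "eval2 (prod F A) p = (\<Prod>x\<in>A. eval2 (F x) p)"
  and eval2_0: "eval2 0 p = 0"
  and eval2_1: "eval2 1 p = 1"
  and eval2_const: "eval2 [:[:c:]:] p = c"
  and eval2_var_s: "eval2 var_s p = fst p"
  and eval2_var_t: "eval2 var_t p = snd p"
  by (simp_all add: eval2_def poly_sum poly_prod var_s_def var_t_def)

lemmas eval2_simps = eval2_add eval2_diff eval2_uminus eval2_mult eval2_power eval2_sum
  eval2_prod eval2_0 eval2_1 eval2_const eval2_var_s eval2_var_t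

text \<open>For each constant \<open>y\<close> the inner polynomials agree everywhere, so
  \<open>f\<close> and \<open>g\<close> agree at the infinitely many elements \<open>[:y:]\<close>
  of the coefficient domain \<open>K[s]\<close>.\<close>

lemma eval2_ext:
  fixes f g :: "'a::alg_closed_field poly poly"
  assumes "\<And>p. eval2 f p = eval2 g p"
  shows "f = g"
proof (rule poly_eqI_infinite)
  have "poly f [:y:] = poly g [:y:]" for y
    using assms[of "(_, y)"] by (intro poly_ext_alg_closed) (simp add: eval2_def)
  then have "range (\<lambda>y. [:y:]) \<subseteq> {x. poly f x = poly g x}" by auto
  moreover have "infinite (range (\<lambda>y::'a. [:y:]))"
    using infinite_UNIV_alg_closed by (auto dest!: finite_imageD simp: inj_on_def)
  ultimately show "infinite {x. poly f x = poly g x}" using finite_subset by blast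
qed

lemma poly_eq_sum_atMost:
  fixes p :: "'a::comm_ring_1 poly"
  assumes "degree p \<le> n"
  shows "poly p x = (\<Sum>j\<le>n. coeff p j * x ^ j)"
proof -
  have "(\<Sum>j\<le>n. coeff p j * x ^ j) = (\<Sum>j\<le>degree p. coeff p j * x ^ j)"
    using assms by (intro sum.mono_neutral_right) (auto simp: coeff_eq_0)
  then show ?thesis by (simp add: poly_altdef)
qed

section \<open>Homogenization, and dehomogenization at \<open>s = 1\<close>\<close>

definition homogenize :: "nat \<Rightarrow> 'a::comm_ring_1 poly \<Rightarrow> 'a poly poly" where
  "homogenize n p = (\<Sum>j\<le>n. monom (monom (coeff p j) (n - j)) j)"

lemma coeff_homogenize:
  "coeff (coeff (homogenize n p) j) i = (if i + j = n then coeff p j else 0)"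
proof -
  have "coeff (coeff (homogenize n p) j) i =
      (\<Sum>k\<le>n. if k = j then (if n - k = i then coeff p k else 0) else 0)"
    by (auto simp: homogenize_def coeff_sum intro!: sum.cong)
  then show ?thesis by (auto simp: sum.delta)
qed

lemma homogeneous_homogenize: "homogeneous n (homogenize n p)"
  by (auto simp: homogeneous_def coeff_homogenize split: if_splits)

lemma eval2_homogenize: "eval2 (homogenize n p) (x, y) = (\<Sum>j\<le>n. coeff p j * x ^ (n - j) * y ^ j)"
  by (simp add: eval2_def homogenize_def poly_sum poly_monom mult_ac)

lemma eval2_homogenize_1: "degree p \<le> n \<Longrightarrow> eval2 (homogenize n p) (1, y) = poly p y"
  by (simp add: eval2_homogenize poly_eq_sum_atMost)

text \<open>At \<open>s = 0\<close> only the summand with \<open>s\<close>-exponent 0 survives. This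
  is why coefficients at a nominal degree stand for values at the point \<open>(0, 1)\<close>
  throughout.\<close>

lemma eval2_homogenize_0: "eval2 (homogenize n p) (0, y) = coeff p n * y ^ n"
proof -
  have "eval2 (homogenize n p) (0, y) = (\<Sum>j\<le>n. if j = n then coeff p j * y ^ j else 0)"
    unfolding eval2_homogenize by (intro sum.cong) (auto simp: zero_power)
  then show ?thesis by simp
qed

definition dehomogenize :: "'a::comm_ring_1 poly poly \<Rightarrow> 'a poly" where
  "dehomogenize f = map_poly (\<lambda>c. poly c 1) f"

lemma coeff_dehomogenize: "coeff (dehomogenize f) j = poly (coeff f j) 1"
  by (simp add: dehomogenize_def coeff_map_poly)

lemma poly_dehomogenize: "poly (dehomogenize f) y = eval2 f (1, y)"
proof (induction f)
  case 0
  then show ?case by (simp add: dehomogenize_def eval2_def)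
next
  case (pCons c f)
  have "dehomogenize (pCons c f) = pCons (poly c 1) (dehomogenize f)"
    unfolding dehomogenize_def by (rule map_poly_pCons) simp
  with pCons show ?case by (simp add: eval2_def)
qed

text \<open>In a form of known degree the exponent of \<open>t\<close> determines that of
  \<open>s\<close>, so nothing is lost by setting \<open>s = 1\<close>. This transports identities
  of forms to univariate polynomials.\<close>

lemma homogeneous_iff_homogenize:
  "homogeneous n f \<longleftrightarrow> f = homogenize n (dehomogenize f)"
proof
  assume hom: "homogeneous n f"
  have "coeff (dehomogenize f) j = coeff (coeff f j) (n - j)" if "j \<le> n" for j
  proof -
    have "coeff f j = monom (coeff (coeff f j) (n - j)) (n - j)"
      using hom that by (intro poly_eqI) (fastforce simp: homogeneous_def)
    then show ?thesis by (metis coeff_dehomogenize poly_monom power_one mult.right_neutral)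
  qed
  moreover have "coeff (coeff f j) i = 0" if "i + j \<noteq> n" for i j
    using hom that by (auto simp: homogeneous_def)
  ultimately show "f = homogenize n (dehomogenize f)"
    by (intro poly_eqI) (auto simp: coeff_homogenize)
qed (metis homogeneous_homogenize)

lemma degree_dehomogenize:
  assumes "homogeneous n f"
  shows "degree (dehomogenize f) \<le> n"
proof (intro degree_le allI impI)
  fix j assume "n < j"
  then have "coeff f j = 0"
    using assms by (intro poly_eqI) (force simp: homogeneous_def)
  then show "coeff (dehomogenize f) j = 0" by (simp add: coeff_dehomogenize)
qed

lemma homogeneous_eqI:
  assumes "homogeneous n f" "homogeneous n g" "dehomogenize f = dehomogenize g"
  shows "f = g"
  using assms by (metis homogeneous_iff_homogenize)

lemma eval2_0_homogeneous:
  assumes "homogeneous n f"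
  shows "eval2 f (0, y) = coeff (dehomogenize f) n * y ^ n"
  using assms eval2_homogenize_0 homogeneous_iff_homogenize by metis

lemma eval2_scale:
  assumes "homogeneous n f"
  shows "eval2 f (c * x, c * y) = c ^ n * eval2 f (x, y)"
proof -
  have "eval2 (homogenize n p) (c * x, c * y) = c ^ n * eval2 (homogenize n p) (x, y)" for p
    unfolding eval2_homogenize sum_distrib_left
  proof (intro sum.cong refl)
    fix j assume "j \<in> {..n}"
    then have "c ^ n = c ^ (n - j) * c ^ j" by (simp flip: power_add)
    then show "coeff p j * (c * x) ^ (n - j) * (c * y) ^ j
        = c ^ n * (coeff p j * x ^ (n - j) * y ^ j)"
      by (simp add: power_mult_distrib mult_ac)
  qed
  then show ?thesis using assms homogeneous_iff_homogenize by metis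
qed

section \<open>Closure properties of forms\<close>

lemma homogeneous_0: "homogeneous n 0"
  by (simp add: homogeneous_def)

lemma homogeneous_add: "homogeneous n f \<Longrightarrow> homogeneous n g \<Longrightarrow> homogeneous n (f + g)"
  unfolding homogeneous_def by (metis add_0 coeff_add)

lemma homogeneous_uminus: "homogeneous n f \<Longrightarrow> homogeneous n (- f)"
  unfolding homogeneous_def by simp

lemma homogeneous_diff: "homogeneous n f \<Longrightarrow> homogeneous n g \<Longrightarrow> homogeneous n (f - g)"
  unfolding diff_conv_add_uminus by (intro homogeneous_add homogeneous_uminus)

lemma homogeneous_sum: "(\<And>x. x \<in> A \<Longrightarrow> homogeneous n (f x)) \<Longrightarrow> homogeneous n (sum f A)"
  by (induction A rule: infinite_finite_induct) (auto simp: homogeneous_0 homogeneous_add)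

lemma coeff_coeff_mult:
  "coeff (coeff (f * g) j) i =
    (\<Sum>k\<le>j. \<Sum>l\<le>i. coeff (coeff f k) l * coeff (coeff g (j - k)) (i - l))"
  by (simp add: coeff_mult coeff_sum)

lemma homogeneous_mult:
  assumes "homogeneous m f" "homogeneous n g"
  shows "homogeneous (m + n) (f * g)"
  unfolding homogeneous_def
proof (intro allI impI)
  fix i j assume "coeff (coeff (f * g) j) i \<noteq> 0"
  then obtain k l where "k \<le> j" "l \<le> i" "coeff (coeff f k) l * coeff (coeff g (j - k)) (i - l) \<noteq> 0"
    unfolding coeff_coeff_mult by (meson atMost_iff sum.not_neutral_contains_not_neutral)
  moreover then have "coeff (coeff f k) l \<noteq> 0" "coeff (coeff g (j - k)) (i - l) \<noteq> 0"
    by auto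
  ultimately have "l + k = m" "(i - l) + (j - k) = n"
    using assms unfolding homogeneous_def by blast+
  with \<open>k \<le> j\<close> \<open>l \<le> i\<close> show "i + j = m + n" by linarith
qed

lemma homogeneous_const: "homogeneous 0 [:[:c:]:]"
  by (auto simp: homogeneous_def coeff_pCons split: nat.splits if_splits)

lemma homogeneous_1: "homogeneous 0 1"
  using homogeneous_const[of 1] by (simp add: one_pCons)

lemma homogeneous_var_s: "homogeneous 1 var_s"
  by (auto simp: homogeneous_def var_s_def coeff_pCons split: nat.splits if_splits)

lemma homogeneous_var_t: "homogeneous 1 var_t"
  by (auto simp: homogeneous_def var_t_def coeff_pCons split: nat.splits if_splits)

lemma homogeneous_power: "homogeneous n f \<Longrightarrow> homogeneous (k * n) (f ^ k)"
  by (induction k) (auto simp: homogeneous_1 intro: homogeneous_mult)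

section \<open>Homogeneous components\<close>

definition hom_part :: "nat \<Rightarrow> 'a::comm_ring_1 poly poly \<Rightarrow> 'a poly poly" where
  "hom_part n f = (\<Sum>j\<le>n. monom (monom (coeff (coeff f j) (n - j)) (n - j)) j)"

lemma coeff_hom_part:
  "coeff (coeff (hom_part n f) j) i = (if i + j = n then coeff (coeff f j) i else 0)"
proof -
  have "coeff (coeff (hom_part n f) j) i =
      (\<Sum>k\<le>n. if k = j then (if n - k = i then coeff (coeff f k) i else 0) else 0)"
    by (auto simp: hom_part_def coeff_sum intro!: sum.cong)
  then show ?thesis by (auto simp: sum.delta)
qed

lemma homogeneous_hom_part: "homogeneous n (hom_part n f)"
  by (auto simp: homogeneous_def coeff_hom_part split: if_splits)

lemma hom_part_homogeneous: "homogeneous n f \<Longrightarrow> hom_part n f = f"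
  by (intro poly_eqI) (auto simp: homogeneous_def coeff_hom_part)

lemma hom_part_sum: "hom_part n (sum f A) = (\<Sum>x\<in>A. hom_part n (f x))"
  by (intro poly_eqI) (simp add: coeff_hom_part coeff_sum)

text \<open>Multiplication by a form of degree \<open>d\<close> shifts the grading by
  \<open>d\<close>: in the convolution every term whose degrees do not add up correctly contains a
  zero coefficient of \<open>g\<close>.\<close>

lemma hom_part_mult:
  assumes "homogeneous d g" "d \<le> n"
  shows "hom_part n (f * g) = hom_part (n - d) f * g"
proof (intro poly_eqI)
  fix i j
  have *: "coeff (coeff g (j - k)) (i - l) = 0"
    if "k \<le> j" "l \<le> i" "\<not> (i + j = n \<longleftrightarrow> l + k = n - d)" for k l
  proof (rule ccontr)
    assume "coeff (coeff g (j - k)) (i - l) \<noteq> 0"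
    then have "(i - l) + (j - k) = d" using assms unfolding homogeneous_def by blast
    with that assms show False by linarith
  qed
  show "coeff (coeff (hom_part n (f * g)) j) i = coeff (coeff (hom_part (n - d) f * g) j) i"
  proof (cases "i + j = n")
    case True
    then show ?thesis
      unfolding coeff_hom_part coeff_coeff_mult if_P[OF True]
      by (intro sum.cong refl) (simp add: *)
  next
    case False
    then show ?thesis
      unfolding coeff_hom_part coeff_coeff_mult if_not_P[OF False]
      by (intro sum.neutral[symmetric] ballI sum.neutral) (use False * in auto)
  qed
qed

lemma hom_part_mult_0:
  assumes "homogeneous d g" "n < d"
  shows "hom_part n (f * g) = 0"
proof (intro poly_eqI)
  fix i j
  have "coeff (coeff g (j - k)) (i - l) = 0" if "i + j = n" for k l
  proof (rule ccontr)
    assume "\<not> ?thesis"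
    then have "(i - l) + (j - k) = d" using assms unfolding homogeneous_def by blast
    with that assms show False by linarith
  qed
  then show "coeff (coeff (hom_part n (f * g)) j) i = coeff (coeff 0 j) i"
    unfolding coeff_hom_part coeff_coeff_mult by (simp add: sum.neutral)
qed

lemma sum_hom_part:
  obtains N where "f = (\<Sum>n\<le>N. hom_part n f)"
proof -
  \<comment> \<open>\<open>M\<close> bounds the degrees in \<open>s\<close> of all coefficients, so
    no monomial of \<open>f\<close> has total degree above \<open>M + degree f\<close>.\<close>
  define M where "M = Max (insert 0 (degree ` (coeff f ` {..degree f})))"
  have M: "degree (coeff f j) \<le> M" for j
  proof (cases "j \<le> degree f")
    case True
    then show ?thesis unfolding M_def by (intro Max_ge) auto
  next
    case False
    then show ?thesis by (simp add: coeff_eq_0)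
  qed
  have "coeff (coeff f j) i = 0" if "i + j > M + degree f" for i j
  proof (cases "j \<le> degree f")
    case True
    then have "degree (coeff f j) < i" using that M[of j] by linarith
    then show ?thesis by (simp add: coeff_eq_0)
  next
    case False
    then show ?thesis by (simp add: coeff_eq_0)
  qed
  then have "f = (\<Sum>n\<le>M + degree f. hom_part n f)"
    by (intro poly_eqI) (auto simp: coeff_sum coeff_hom_part not_le)
  then show thesis by (rule that)
qed

text \<open>If the coefficient at the nominal degree vanishes, \<open>(0, 1)\<close> is a zero;
  otherwise \<open>dehomogenize f\<close> is nonconstant and has a root.\<close>

lemma homogeneous_root_dehomogenize:
  fixes f :: "'a::alg_closed_field poly poly"
  assumes "homogeneous n f" "n > 0"
  obtains z where "z \<in> line_cone" "eval2 f z = 0"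
proof (cases "coeff (dehomogenize f) n = 0")
  case True
  then have "eval2 f (0, 1) = 0" using eval2_0_homogeneous[OF assms(1), of 1] by simp
  then show thesis by (intro that[of "(0, 1)"]) (auto simp: line_cone_def)
next
  case False
  then have "degree (dehomogenize f) > 0"
    using assms(2) le_degree[of "dehomogenize f" n] by linarith
  then obtain y where "poly (dehomogenize f) y = 0" using alg_closed_imp_poly_has_root by blast
  then show thesis by (intro that[of "(1, y)"]) (auto simp: line_cone_def poly_dehomogenize)
qed

lemma dehomogenize_mult:
  fixes f g :: "'a::alg_closed_field poly poly"
  shows "dehomogenize (f * g) = dehomogenize f * dehomogenize g"
  by (rule poly_ext_alg_closed) (simp add: poly_dehomogenize eval2_simps)

lemma dehomogenize_0: "dehomogenize 0 = 0"
  by (rule poly_eqI) (simp add: coeff_dehomogenize)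

lemma dehomogenize_sum: "dehomogenize (sum f A) = (\<Sum>x\<in>A. dehomogenize (f x))"
  by (rule poly_eqI) (simp add: coeff_dehomogenize coeff_sum poly_sum)

lemma dehomogenize_homogenize:
  fixes p :: "'a::alg_closed_field poly"
  shows "degree p \<le> n \<Longrightarrow> dehomogenize (homogenize n p) = p"
  by (rule poly_ext_alg_closed) (simp add: poly_dehomogenize eval2_homogenize_1)

text \<open>Vanishing at \<open>(0, 1)\<close> lowers the degree of the dehomogenization to at most
  \<open>n\<close>, and multiplication by \<open>s\<close> does not change the dehomogenization. The
  quotient is therefore the same univariate polynomial, homogenized in degree
  \<open>n\<close>.\<close>

lemma var_s_dvd_homogeneous:
  fixes f :: "'a::alg_closed_field poly poly"
  assumes "homogeneous (Suc n) f" "eval2 f (0, 1) = 0"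
  obtains g where "homogeneous n g" "f = var_s * g"
proof -
  define p where "p = dehomogenize f"
  have p: "degree p \<le> n"
  proof -
    have "degree p \<le> Suc n" "coeff p (Suc n) = 0"
      using assms eval2_0_homogeneous[OF assms(1), of 1] degree_dehomogenize[OF assms(1)]
      by (auto simp: p_def)
    then show ?thesis by (metis degree_0 le0 le_SucE leading_coeff_0_iff)
  qed
  have "f = var_s * homogenize n p"
  proof (rule homogeneous_eqI)
    show "homogeneous (Suc n) (var_s * homogenize n p)"
      using homogeneous_mult[OF homogeneous_var_s homogeneous_homogenize] by simp
    show "dehomogenize f = dehomogenize (var_s * homogenize n p)"
      using p by (intro poly_ext_alg_closed)
        (simp add: poly_dehomogenize eval2_simps eval2_homogenize_1 flip: p_def)
  qed (rule assms)
  then show thesis by (intro that[OF homogeneous_homogenize])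
qed

section \<open>Syzygies of three univariate polynomials\<close>

lemma UNIV_3_rotate: "(UNIV :: 3 set) = {i, i + 1, i + 2}"
  and distinct_3_rotate: "i + 1 \<noteq> i" "i + 2 \<noteq> i" "i + 1 \<noteq> i + (2 :: 3)"
proof -
  have "card (UNIV :: 3 set) = 3" by simp
  moreover have ne: "(1 :: 3) \<noteq> 0" "(2 :: 3) \<noteq> 0" "(1 :: 3) \<noteq> 2" by simp_all
  then show d: "i + 1 \<noteq> i" "i + 2 \<noteq> i" "i + 1 \<noteq> i + (2 :: 3)" by simp_all
  then have "card {i, i + 1, i + 2} = 3" by auto
  ultimately show "(UNIV :: 3 set) = {i, i + 1, i + 2}"
    by (metis card_subset_eq finite subset_UNIV)
qed

lemma sum_3: "(\<Sum>j\<in>UNIV. f j) = f i + f (i + 1) + f (i + (2 :: 3))"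
  using distinct_3_rotate[of i] by (subst UNIV_3_rotate[of i]) (auto simp: add_ac)

lemma exhaust_3: obtains "j = i" | "j = i + 1" | "j = i + (2 :: 3)"
  using UNIV_3_rotate[of i] by blast

lemma rotate_3: "i + 1 + 1 = i + 2" "i + 1 + 2 = i" "i + 2 + 1 = i" "i + 2 + 2 = i + (1 :: 3)"
  by (simp_all add: add.assoc)

definition cross :: "(3 \<Rightarrow> 'a::comm_ring) \<Rightarrow> (3 \<Rightarrow> 'a) \<Rightarrow> 3 \<Rightarrow> 'a" where
  "cross x y i = x (i + 1) * y (i + 2) - x (i + 2) * y (i + 1)"

text \<open>Both vectors are orthogonal to \<open>f\<close>, so their cross product is proportional
  to \<open>f\<close>. The proportionality is cross-multiplied so that it also serves for triples of
  polynomials.\<close>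

lemma cross_parallel:
  fixes x y f :: "3 \<Rightarrow> 'a::idom"
  assumes "(\<Sum>i\<in>UNIV. x i * f i) = 0" "(\<Sum>i\<in>UNIV. y i * f i) = 0"
  shows "cross x y i * f j = cross x y j * f i"
proof -
  have *: "cross x y i * f (i + 1) = cross x y (i + 1) * f i" for i
    using assms unfolding sum_3[of _ i] cross_def rotate_3 by algebra
  show ?thesis
    using *[of i] *[of "i + 2"] by (cases j i rule: exhaust_3) (simp_all add: rotate_3)
qed

lemma cross_nonzero:
  fixes x y :: "3 \<Rightarrow> 'a::field"
  assumes "\<And>\<alpha> \<beta>. (\<And>i. \<alpha> * x i + \<beta> * y i = 0) \<Longrightarrow> \<alpha> = 0 \<and> \<beta> = 0"
  obtains i where "cross x y i \<noteq> 0"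
proof (rule ccontr)
  assume "\<not> thesis"
  with that have 0: "cross x y i = 0" for i by blast
  obtain i where i: "x i \<noteq> 0" using assms[of 1 0] by auto
  \<comment> \<open>With all minors zero, this is a linear relation between \<open>x\<close> and
    \<open>y\<close> whose coefficient \<open>- x i\<close> is nonzero.\<close>
  have "y i * x j + - x i * y j = 0" for j
    using 0[of "i + 1"] 0[of "i + 2"]
    unfolding cross_def rotate_3 by (cases j i rule: exhaust_3) (simp_all add: mult_ac)
  from assms[OF this] i show False by simp
qed

text \<open>Cramer's rule on the coordinates \<open>k + 1\<close> and \<open>k + 2\<close>, whose
  minor is \<open>cross x y k\<close>. Coordinate \<open>k\<close> then follows from orthogonality
  to the cross product, which is parallel to \<open>f\<close>.\<close>

lemma orthogonal_span:
  fixes x y f r :: "3 \<Rightarrow> 'a::field"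
  assumes "(\<Sum>i\<in>UNIV. x i * f i) = 0" "(\<Sum>i\<in>UNIV. y i * f i) = 0"
    and "(\<Sum>i\<in>UNIV. r i * f i) = 0" "f k \<noteq> 0" "cross x y k \<noteq> 0"
  obtains \<alpha> \<beta> where "\<And>i. r i = \<alpha> * x i + \<beta> * y i"
proof
  fix j
  let ?n = "cross x y"
  define \<alpha> where "\<alpha> = (r (k + 1) * y (k + 2) - r (k + 2) * y (k + 1)) / ?n k"
  define \<beta> where "\<beta> = (x (k + 1) * r (k + 2) - x (k + 2) * r (k + 1)) / ?n k"
  have "f k * (\<Sum>i\<in>UNIV. r i * ?n i) = ?n k * (\<Sum>i\<in>UNIV. r i * f i)"
    unfolding sum_distrib_left
  proof (rule sum.cong)
    fix i
    show "f k * (r i * ?n i) = ?n k * (r i * f i)"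
      using cross_parallel[OF assms(1,2), of k i] by algebra
  qed simp
  with assms have "(\<Sum>i\<in>UNIV. r i * ?n i) = 0" by simp
  then have 0: "r k * ?n k + r (k + 1) * ?n (k + 1) + r (k + 2) * ?n (k + 2) = 0"
    unfolding sum_3[of _ k] .
  have "?n k * r j = (r (k + 1) * y (k + 2) - r (k + 2) * y (k + 1)) * x j
      + (x (k + 1) * r (k + 2) - x (k + 2) * r (k + 1)) * y j"
  proof (cases j k rule: exhaust_3)
    case 1
    with 0 show ?thesis unfolding cross_def rotate_3 1 by algebra
  qed (simp_all add: cross_def algebra_simps)
  with assms(5) show "r j = \<alpha> * x j + \<beta> * y j"
    by (simp add: \<alpha>_def \<beta>_def divide_simps mult_ac)
qed

text \<open>A nonzero element of least degree in the ideal divides every \<open>f i\<close>, by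
  division with remainder. A root of it would be a common root, so it is a constant.\<close>

lemma bezout_of_no_common_root:
  fixes f :: "'i::finite \<Rightarrow> 'a::alg_closed_field poly"
  assumes no_root: "\<And>y. \<exists>i. poly (f i) y \<noteq> 0"
  obtains u where "(\<Sum>i\<in>UNIV. u i * f i) = 1"
proof -
  define I where "I = {\<Sum>i\<in>UNIV. u i * f i | u. True}"
  define g where "g = arg_min degree (\<lambda>g. g \<in> I \<and> g \<noteq> 0)"
  have fI: "f i \<in> I" for i
  proof -
    have "f i = (\<Sum>j\<in>UNIV. (if j = i then 1 else 0) * f j)"
      by (simp add: if_distrib[of "\<lambda>x. x * _"] cong: if_cong)
    then show ?thesis unfolding I_def by (intro CollectI exI[of _ "\<lambda>j. if j = i then 1 else 0"]) simp
  qed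
  obtain i where "f i \<noteq> 0" using no_root[of 0] by (metis poly_0)
  with fI have ex: "f i \<in> I \<and> f i \<noteq> 0" by blast
  have g: "g \<in> I" "g \<noteq> 0" and min: "h \<in> I \<Longrightarrow> h \<noteq> 0 \<Longrightarrow> degree g \<le> degree h" for h
    using arg_min_nat_lemma[where P = "\<lambda>g. g \<in> I \<and> g \<noteq> 0" and m = degree, OF ex]
    unfolding g_def by blast+
  obtain u where u: "g = (\<Sum>i\<in>UNIV. u i * f i)" using g(1) unfolding I_def by blast
  have dvd: "g dvd f i" for i
  proof (rule ccontr)
    assume "\<not> g dvd f i"
    then have nz: "f i mod g \<noteq> 0" by (simp add: mod_eq_0_iff_dvd)
    have "f i mod g = f i - (f i div g) * g" by (simp add: minus_div_mult_eq_mod)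
    also have "\<dots> = (\<Sum>j\<in>UNIV. ((if j = i then 1 else 0) - (f i div g) * u j) * f j)"
      unfolding u by (simp add: left_diff_distrib sum_subtractf sum_distrib_left mult.assoc
          if_distrib[of "\<lambda>x. x * _"] cong: if_cong)
    finally have "f i mod g \<in> I"
      unfolding I_def by (intro CollectI exI[of _ "\<lambda>j. (if j = i then 1 else 0) - (f i div g) * u j"]) simp
    from min[OF this nz] degree_mod_less[OF g(2), of "f i"] nz show False by auto
  qed
  have "degree g = 0"
  proof (rule ccontr)
    assume "degree g \<noteq> 0"
    then obtain y where "poly g y = 0" using alg_closed_imp_poly_has_root by blast
    then have "poly (f i) y = 0" for i using dvd[of i] by (metis dvdE mult_zero_left poly_mult)
    with no_root show False by blast
  qed
  then obtain c where c: "g = [:c:]" by (meson degree_eq_zeroE)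
  with g have "c \<noteq> 0" by auto
  have "(\<Sum>i\<in>UNIV. ([:inverse c:] * u i) * f i) = [:inverse c:] * g"
    unfolding u by (simp only: sum_distrib_left mult.assoc)
  also have "\<dots> = 1" using \<open>c \<noteq> 0\<close> by (simp add: c one_pCons)
  finally show thesis by (rule that)
qed

lemma coeff_mult_top:
  assumes "degree p \<le> m" "degree q \<le> n"
  shows "coeff (p * q) (m + n) = coeff p m * coeff q n"
proof -
  have "coeff (p * q) (m + n) = (\<Sum>i\<le>m + n. if i = m then coeff p i * coeff q n else 0)"
    unfolding coeff_mult
  proof (intro sum.cong refl)
    fix i assume "i \<in> {..m + n}"
    consider "i < m" | "i = m" | "i > m" by linarith
    then show "coeff p i * coeff q (m + n - i) = (if i = m then coeff p i * coeff q n else 0)"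
    proof cases
      case 1
      then have "degree q < m + n - i" using assms by linarith
      with 1 show ?thesis by (simp add: coeff_eq_0)
    next
      case 3
      with assms show ?thesis by (simp add: coeff_eq_0)
    qed simp
  qed
  then show ?thesis by simp
qed

text \<open>The forms are dehomogenized by setting \<open>s = 1\<close>; the coefficients at the nominal degrees
  are then the values at the point \<open>(0, 1)\<close>.\<close>

locale syzygy_basis =
  fixes f P Q :: "3 \<Rightarrow> 'a::alg_closed_field poly" and d a b :: nat
  assumes deg_f: "degree (f i) \<le> d"
    and deg_P: "degree (P i) \<le> a"
    and deg_Q: "degree (Q i) \<le> b"
    and ab: "a + b = d" "a \<le> b" "b > 0"
    and syz_P: "(\<Sum>i\<in>UNIV. P i * f i) = 0"
    and syz_Q: "(\<Sum>i\<in>UNIV. Q i * f i) = 0"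
    and no_root: "\<And>y. \<exists>i. poly (f i) y \<noteq> 0"
    and top_f: "\<exists>i. coeff (f i) d \<noteq> 0"
    and indep: "\<And>\<alpha> \<beta>. (\<And>i. \<alpha> * coeff (P i) a + \<beta> * coeff (Q i) b = 0) \<Longrightarrow> \<alpha> = 0 \<and> \<beta> = 0"
begin

abbreviation "p \<equiv> \<lambda>i. coeff (P i) a"
abbreviation "q \<equiv> \<lambda>i. coeff (Q i) b"
abbreviation "lead \<equiv> \<lambda>i. coeff (f i) d"

text \<open>Coefficients at nominal degrees multiply like values at \<open>(0, 1)\<close>, so this
  evaluates the combination at that point.\<close>

lemma top_syzygy:
  assumes "\<And>i. degree (r i) \<le> m"
  shows "(\<Sum>i\<in>UNIV. coeff (r i) m * lead i) = coeff (\<Sum>i\<in>UNIV. r i * f i) (m + d)"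
  using assms deg_f by (simp add: coeff_sum coeff_mult_top)

lemma top_syz: "(\<Sum>i\<in>UNIV. p i * lead i) = 0" "(\<Sum>i\<in>UNIV. q i * lead i) = 0"
  using top_syzygy[of P a] top_syzygy[of Q b] deg_P deg_Q syz_P syz_Q by simp_all

text \<open>The cross product of \<open>p\<close> and \<open>q\<close> is nonzero by independence
  and parallel to the nonzero vector \<open>lead\<close>, so both vanish in the same
  coordinates.\<close>

lemma cross_top: "cross p q k \<noteq> 0 \<longleftrightarrow> lead k \<noteq> 0"
proof -
  obtain i where i: "cross p q i \<noteq> 0" using cross_nonzero[of p q] indep by blast
  obtain j where j: "lead j \<noteq> 0" using top_f by blast
  note par = cross_parallel[OF top_syz]
  have "lead i \<noteq> 0" using par[of i j] i j by auto
  with par[of i k] i show ?thesis by auto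
qed

text \<open>Lowering the nominal degree is the affine form of dividing by \<open>s\<close>. The
  degree bound on the sum makes the value of \<open>r\<close> at \<open>(0, 1)\<close> orthogonal to
  \<open>lead\<close>, and \<open>b \<le> Suc m\<close> leaves room for the shifted multiples of
  \<open>P\<close> and \<open>Q\<close> that cancel this value.\<close>

lemma reduce_degree:
  assumes "\<And>i. degree (r i) \<le> Suc m" "b \<le> Suc m" "degree (\<Sum>i\<in>UNIV. r i * f i) \<le> m + d"
  obtains r' where "\<And>i. degree (r' i) \<le> m" "(\<Sum>i\<in>UNIV. r' i * f i) = (\<Sum>i\<in>UNIV. r i * f i)"
proof -
  obtain k where k: "lead k \<noteq> 0" using top_f by blast
  have "(\<Sum>i\<in>UNIV. coeff (r i) (Suc m) * lead i) = 0"
    unfolding top_syzygy[OF assms(1)] using assms(3) by (intro coeff_eq_0) simp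
  from orthogonal_span[OF top_syz this k] k obtain \<alpha> \<beta> where
    *: "\<And>i. coeff (r i) (Suc m) = \<alpha> * p i + \<beta> * q i"
    using cross_top by blast
  define r' where "r' i = r i - monom \<alpha> (Suc m - a) * P i - monom \<beta> (Suc m - b) * Q i" for i
  have "degree (r' i) \<le> m" for i
  proof -
    have "degree (monom \<alpha> (Suc m - a) * P i) \<le> Suc m"
      using degree_mult_le[of "monom \<alpha> (Suc m - a)" "P i"] degree_monom_le[of \<alpha> "Suc m - a"]
        deg_P[of i] assms(2) ab by linarith
    moreover have "degree (monom \<beta> (Suc m - b) * Q i) \<le> Suc m"
      using degree_mult_le[of "monom \<beta> (Suc m - b)" "Q i"] degree_monom_le[of \<beta> "Suc m - b"]
        deg_Q[of i] assms(2) ab by linarith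
    ultimately have "degree (r' i) \<le> Suc m"
      unfolding r'_def using assms(1) by (intro degree_diff_le) auto
    moreover have "coeff (monom c (n - k) * x) n = c * coeff x k"
      if "k \<le> n" for c n k and x :: "'a poly"
      using that by (simp add: coeff_monom_mult)
    from this[of a "Suc m"] this[of b "Suc m"] have "coeff (r' i) (Suc m) = 0"
      unfolding r'_def using *[of i] assms(2) ab by simp
    ultimately show ?thesis by (metis degree_0 le0 le_SucE leading_coeff_0_iff)
  qed
  moreover have "(\<Sum>i\<in>UNIV. r' i * f i) = (\<Sum>i\<in>UNIV. r i * f i)
      - monom \<alpha> (Suc m - a) * (\<Sum>i\<in>UNIV. P i * f i) - monom \<beta> (Suc m - b) * (\<Sum>i\<in>UNIV. Q i * f i)"
    by (simp add: r'_def left_diff_distrib sum_subtractf sum_distrib_left mult.assoc)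
  ultimately show thesis using that[of r'] syz_P syz_Q by simp
qed

text \<open>A Bezout identity multiplied by \<open>h\<close> is a representation in some degree
  \<open>m + M\<close>. Since \<open>h\<close> has degree at most \<open>m + d\<close>,
  \<open>reduce_degree\<close> applies \<open>M\<close> times.\<close>

lemma representable:
  assumes "degree h \<le> m + d" "b \<le> Suc m"
  obtains r where "\<And>i. degree (r i) \<le> m" "(\<Sum>i\<in>UNIV. r i * f i) = h"
proof -
  obtain u where u: "(\<Sum>i\<in>UNIV. u i * f i) = 1" using bezout_of_no_common_root[of f] no_root by blast
  define M where "M = Max (range (\<lambda>i. degree (h * u i)))"
  have *: "\<exists>r. (\<forall>i. degree (r i) \<le> m) \<and> (\<Sum>i\<in>UNIV. r i * f i) = h"
    if "\<forall>i. degree (r i) \<le> m + k" "(\<Sum>i\<in>UNIV. r i * f i) = h" for r k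
    using that
  proof (induction k arbitrary: r)
    case (Suc k)
    then have "degree (r i) \<le> Suc (m + k)" for i by simp
    moreover have "b \<le> Suc (m + k)" "degree (\<Sum>i\<in>UNIV. r i * f i) \<le> m + k + d"
      using assms by (simp_all add: Suc.prems(2))
    ultimately obtain r' where "\<forall>i. degree (r' i) \<le> m + k" "(\<Sum>i\<in>UNIV. r' i * f i) = h"
      using reduce_degree[of r "m + k"] Suc.prems(2) by metis
    then show ?case by (rule Suc.IH)
  qed auto
  have "degree (h * u i) \<le> m + M" for i
    unfolding M_def by (rule trans_le_add2, rule Max_ge) auto
  moreover have "(\<Sum>i\<in>UNIV. (h * u i) * f i) = h"
    using u by (simp add: mult.assoc flip: sum_distrib_left)
  ultimately show thesis using *[of "\<lambda>i. h * u i" M] that by blast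
qed

text \<open>The degree bound \<open>b - 2\<close> on \<open>r\<close> is expressed by vanishing
  coefficients, so that for \<open>b = 1\<close> it means \<open>r = 0\<close>.\<close>

lemma not_representable:
  obtains h where "degree h + 2 \<le> b + d"
    "\<forall>r. (\<forall>i k. b \<le> Suc k \<longrightarrow> coeff (r i) k = 0) \<longrightarrow> (\<Sum>i\<in>UNIV. r i * f i) \<noteq> h"
proof
  \<comment> \<open>\<open>B\<close> is the value of \<open>Q\<close> at \<open>(0, 1)\<close> times
    a monomial of degree \<open>b - 1\<close>. As \<open>q\<close> is orthogonal to
    \<open>lead\<close>, the degree of \<open>h\<close> is smaller than the expected
    \<open>b - 1 + d\<close>.\<close>
  define B where "B i = monom (q i) (b - 1)" for i
  define h where "h = (\<Sum>i\<in>UNIV. B i * f i)"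
  have deg_B: "degree (B i) \<le> b - 1" for i by (simp add: B_def degree_monom_le)
  have "coeff h k = 0" if "k + 2 > b + d" for k
  proof (cases "k + 1 = b + d")
    case True
    then have k: "k = b - 1 + d" using ab by linarith
    have "coeff h k = (\<Sum>i\<in>UNIV. q i * lead i)"
      unfolding h_def k using top_syzygy[of B "b - 1"] deg_B by (simp add: B_def)
    then show ?thesis by (simp add: top_syz)
  next
    case False
    have "degree (B i * f i) \<le> b - 1 + d" for i
      using degree_mult_le[of "B i" "f i"] deg_B[of i] deg_f[of i] by linarith
    then have "degree h \<le> b - 1 + d" unfolding h_def by (intro degree_sum_le) auto
    then show ?thesis using False that ab by (intro coeff_eq_0) linarith
  qed
  moreover have "b + d \<ge> 2" using ab by linarith
  ultimately have "degree h \<le> b + d - 2" by (intro degree_le) auto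
  then show "degree h + 2 \<le> b + d" using \<open>b + d \<ge> 2\<close> by linarith
  have "(\<Sum>i\<in>UNIV. r i * f i) \<noteq> h"
    if r: "\<And>i k. b \<le> Suc k \<Longrightarrow> coeff (r i) k = 0" for r
  proof
    assume eq: "(\<Sum>i\<in>UNIV. r i * f i) = h"
    \<comment> \<open>The difference of two representations of \<open>h\<close> is a syzygy of
      nominal degree \<open>b - 1\<close>. The coefficients of \<open>r\<close> vanish at
      \<open>b - 1\<close>, so it keeps the value \<open>q\<close> at \<open>(0, 1)\<close>.\<close>
    define W where "W i = B i - r i" for i
    have W: "(\<Sum>i\<in>UNIV. W i * f i) = 0"
      using eq by (simp add: W_def h_def left_diff_distrib sum_subtractf)
    have deg_W: "degree (W i) \<le> b - 1" for i
      unfolding W_def using deg_B r by (intro degree_diff_le) (auto intro!: degree_le)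
    have top_W: "coeff (W i) (b - 1) = q i" for i
      unfolding W_def using r[of "b - 1" i] ab by (simp add: B_def)
    obtain u where u: "(\<Sum>i\<in>UNIV. u i * f i) = 1"
      using bezout_of_no_common_root[of f] no_root by blast
    \<comment> \<open>For this \<open>k\<close> the polynomial \<open>f k\<close> has exact degree
      \<open>d\<close>, which exceeds the degree of \<open>V k\<close>.\<close>
    obtain k where k: "lead k \<noteq> 0" using top_f by blast
    define V where "V = cross W P"
    have deg_f_k: "degree (f k) = d" using k deg_f[of k] le_degree by (metis le_antisym)
    have "degree (V k) \<le> b - 1 + a"
      unfolding V_def cross_def
      using degree_mult_le[of "W (k + 1)" "P (k + 2)"] degree_mult_le[of "W (k + 2)" "P (k + 1)"]
        deg_W[of "k + 1"] deg_W[of "k + 2"] deg_P[of "k + 1"] deg_P[of "k + 2"]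
      by (intro degree_diff_le) linarith+
    then have deg_V: "degree (V k) < d" using ab by linarith
    have "coeff (W i * P j) (b - 1 + a) = q i * p j" for i j
      using coeff_mult_top[OF deg_W deg_P] top_W by simp
    then have "coeff (V k) (b - 1 + a) = - cross p q k"
      unfolding V_def cross_def coeff_diff by simp
    moreover have "cross p q k \<noteq> 0" using cross_top[of k] k by blast
    ultimately have "V k \<noteq> 0" by (metis coeff_0 neg_equal_0_iff_equal)
    \<comment> \<open>Multiplying the Bezout identity by \<open>V k\<close> and exchanging indices
      by parallelism shows that \<open>f k\<close> divides \<open>V k\<close>.\<close>
    have "V k = (\<Sum>i\<in>UNIV. u i * f i) * V k" by (simp add: u)
    also have "\<dots> = (\<Sum>i\<in>UNIV. u i * V i) * f k"
      unfolding sum_distrib_right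
    proof (intro sum.cong refl)
      fix i
      show "u i * f i * V k = u i * V i * f k"
        using cross_parallel[OF W syz_P, of k i] unfolding V_def by algebra
    qed
    finally have "f k dvd V k" by simp
    from dvd_imp_degree_le[OF this \<open>V k \<noteq> 0\<close>] deg_V deg_f_k show False by simp
  qed
  then show "\<forall>r. (\<forall>i k. b \<le> Suc k \<longrightarrow> coeff (r i) k = 0) \<longrightarrow> (\<Sum>i\<in>UNIV. r i * f i) \<noteq> h"
    by blast
qed

end

section \<open>The saturation degree\<close>

lemma module_mult: "module ((*) :: 'a::comm_ring_1 \<Rightarrow> 'a \<Rightarrow> 'a)"
  by unfold_locales (simp_all add: algebra_simps)

lemma ideal_generated_0: "0 \<in> ideal_generated G"
  and ideal_generated_base: "g \<in> G \<Longrightarrow> g \<in> ideal_generated G"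
  and ideal_generated_add:
    "x \<in> ideal_generated G \<Longrightarrow> y \<in> ideal_generated G \<Longrightarrow> x + y \<in> ideal_generated G"
  and ideal_generated_mult: "x \<in> ideal_generated G \<Longrightarrow> c * x \<in> ideal_generated G"
  and ideal_generated_sum:
    "(\<And>a. a \<in> A \<Longrightarrow> f a \<in> ideal_generated G) \<Longrightarrow> sum f A \<in> ideal_generated G"
  unfolding ideal_generated_def
  by (auto intro: module.span_zero module.span_base module.span_add module.span_scale
      module.span_sum module_mult)

lemma ideal_generated_minimal:
  assumes "G \<subseteq> I" "0 \<in> I" "\<And>x y. x \<in> I \<Longrightarrow> y \<in> I \<Longrightarrow> x + y \<in> I"
    "\<And>c x. x \<in> I \<Longrightarrow> c * x \<in> I"
  shows "ideal_generated G \<subseteq> I"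
  unfolding ideal_generated_def
  using assms by (intro module.span_minimal module_mult module.subspaceI[OF module_mult]) auto

lemma in_ideal_generated_range:
  fixes g :: "'i::finite \<Rightarrow> 'a::comm_ring_1"
  shows "h \<in> ideal_generated (range g) \<longleftrightarrow> (\<exists>r. h = (\<Sum>i\<in>UNIV. r i * g i))"
proof
  have "ideal_generated (range g) \<subseteq> {h. \<exists>r. h = (\<Sum>i\<in>UNIV. r i * g i)}"
  proof (rule ideal_generated_minimal; safe?)
    fix j
    show "\<exists>r. g j = (\<Sum>i\<in>UNIV. r i * g i)"
      by (rule exI[of _ "\<lambda>i. if i = j then 1 else 0"])
        (simp add: if_distrib[of "\<lambda>x. x * _"] cong: if_cong)
  next
    show "\<exists>r. 0 = (\<Sum>i\<in>UNIV. r i * g i)" by (rule exI[of _ "\<lambda>i. 0"]) simp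
  next
    fix r r'
    show "\<exists>r''. (\<Sum>i\<in>UNIV. r i * g i) + (\<Sum>i\<in>UNIV. r' i * g i) = (\<Sum>i\<in>UNIV. r'' i * g i)"
      by (rule exI[of _ "\<lambda>i. r i + r' i"]) (simp add: sum.distrib distrib_right)
  next
    fix c r
    show "\<exists>r'. c * (\<Sum>i\<in>UNIV. r i * g i) = (\<Sum>i\<in>UNIV. r' i * g i)"
      by (rule exI[of _ "\<lambda>i. c * r i"]) (simp add: sum_distrib_left mult.assoc)
  qed
  then show "\<exists>r. h = (\<Sum>i\<in>UNIV. r i * g i)" if "h \<in> ideal_generated (range g)" using that by blast
qed (auto intro!: ideal_generated_sum ideal_generated_mult intro: ideal_generated_base)

section \<open>Powers of the irrelevant ideal \<open>(s, t)\<close>\<close>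

definition order_ge :: "nat \<Rightarrow> 'a::comm_ring_1 poly poly set" where
  "order_ge n = {f. \<forall>i j. coeff (coeff f j) i \<noteq> 0 \<longrightarrow> n \<le> i + j}"

lemma order_ge_add: "f \<in> order_ge n \<Longrightarrow> g \<in> order_ge n \<Longrightarrow> f + g \<in> order_ge n"
  unfolding order_ge_def mem_Collect_eq by (metis add_0 coeff_add)

lemma order_ge_mult:
  assumes "f \<in> order_ge m" "g \<in> order_ge n"
  shows "f * g \<in> order_ge (m + n)"
  unfolding order_ge_def mem_Collect_eq
proof (intro allI impI)
  fix i j assume "coeff (coeff (f * g) j) i \<noteq> 0"
  then obtain k l where "k \<le> j" "l \<le> i" "coeff (coeff f k) l * coeff (coeff g (j - k)) (i - l) \<noteq> 0"
    unfolding coeff_coeff_mult by (meson atMost_iff sum.not_neutral_contains_not_neutral)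
  moreover then have "coeff (coeff f k) l \<noteq> 0" "coeff (coeff g (j - k)) (i - l) \<noteq> 0"
    by auto
  ultimately have "m \<le> l + k" "n \<le> (i - l) + (j - k)"
    using assms unfolding order_ge_def by blast+
  with \<open>k \<le> j\<close> \<open>l \<le> i\<close> show "m + n \<le> i + j" by linarith
qed

lemma ideal_generated_order_ge: "G \<subseteq> order_ge n \<Longrightarrow> ideal_generated G \<subseteq> order_ge n"
proof (intro ideal_generated_minimal order_ge_add)
  show "c * x \<in> order_ge n" if "x \<in> order_ge n" for c x :: "'a poly poly"
    using order_ge_mult[of c 0 x n] that by (simp add: order_ge_def)
qed (auto simp: order_ge_def)

text \<open>Orders add under multiplication and elements of \<open>(s, t)\<close> have order at
  least 1. This confines the homogeneous components of an element of the power to degrees at least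
  \<open>n\<close>.\<close>

lemma ideal_power_irrelevant_subset_order_ge: "ideal_power irrelevant_ideal n \<subseteq> order_ge n"
  unfolding ideal_power_def
proof (rule ideal_generated_order_ge, rule subsetI)
  fix g :: "'a poly poly"
  assume "g \<in> {\<Prod>k<n. f k | f. \<forall>k<n. f k \<in> irrelevant_ideal}"
  then obtain f where f: "\<forall>k<n. f k \<in> irrelevant_ideal" and g: "g = (\<Prod>k<n. f k)" by blast
  have "(irrelevant_ideal :: 'a poly poly set) \<subseteq> order_ge 1"
    unfolding irrelevant_ideal_def using homogeneous_var_s homogeneous_var_t
    by (intro ideal_generated_order_ge) (fastforce simp: order_ge_def homogeneous_def)
  with f have "(\<Prod>k<m. f k) \<in> order_ge m" if "m \<le> n" for m
    using that
  proof (induction m)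
    case 0
    then show ?case by (simp add: order_ge_def)
  next
    case (Suc m)
    then have "f m \<in> order_ge 1" using Suc_le_lessD by blast
    with Suc show ?case using order_ge_mult[of "\<Prod>k<m. f k" m "f m" 1] by simp
  qed
  then show "g \<in> order_ge n" unfolding g by simp
qed

lemma monomial_in_ideal_power_irrelevant:
  assumes "i \<le> k + j"
  shows "var_s ^ k * var_t ^ j \<in> ideal_power irrelevant_ideal i"
proof -
  define v :: "nat \<Rightarrow> 'a poly poly" where "v l = (if l < k then var_s else var_t)" for l
  have v: "v l \<in> irrelevant_ideal" for l
    by (auto simp: v_def irrelevant_ideal_def intro: ideal_generated_base)
  have "{..<k + j} = {..<k} \<union> {k..<k + j}" by auto
  then have "(\<Prod>l<k + j. v l) = (\<Prod>l<k. v l) * (\<Prod>l=k..<k + j. v l)"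
    by (simp add: prod.union_disjoint ivl_disj_int_one(2))
  also have "\<dots> = var_s ^ k * var_t ^ j" by (simp add: v_def)
  finally have "var_s ^ k * var_t ^ j = (\<Prod>l<k + j. v l)" ..
  \<comment> \<open>The first \<open>i\<close> factors form a generator of the power; the remaining
    ones become its multiplier.\<close>
  also have "{..<k + j} = {i..<k + j} \<union> {..<i}" using assms by auto
  also have "(\<Prod>l\<in>{i..<k + j} \<union> {..<i}. v l) = (\<Prod>l=i..<k + j. v l) * (\<Prod>l<i. v l)"
    by (intro prod.union_disjoint) auto
  finally show ?thesis
    unfolding ideal_power_def using v by (auto intro!: ideal_generated_mult intro: ideal_generated_base)
qed

lemma monom_monom_eq:
  fixes c :: "'a::alg_closed_field"
  shows "monom (monom c k) j = [:[:c:]:] * (var_s ^ k * var_t ^ j)"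
proof (rule eval2_ext)
  fix p
  show "eval2 (monom (monom c k) j) p = eval2 ([:[:c:]:] * (var_s ^ k * var_t ^ j)) p"
    unfolding eval2_simps by (simp add: eval2_def poly_monom)
qed

lemma homogeneous_in_ideal_power_irrelevant:
  fixes f :: "'a::alg_closed_field poly poly"
  assumes "homogeneous n f" "i \<le> n"
  shows "f \<in> ideal_power irrelevant_ideal i"
proof -
  have "monom (monom c (n - j)) j \<in> ideal_power irrelevant_ideal i" if "j \<le> n" for c :: 'a and j
  proof -
    have "var_s ^ (n - j) * var_t ^ j \<in> ideal_power (irrelevant_ideal :: 'a poly poly set) i"
      using that assms(2) by (intro monomial_in_ideal_power_irrelevant) simp
    then show ?thesis
      unfolding monom_monom_eq ideal_power_def by (rule ideal_generated_mult)
  qed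
  then have "homogenize n (dehomogenize f) \<in> ideal_power irrelevant_ideal i"
    unfolding homogenize_def ideal_power_def by (intro ideal_generated_sum) simp
  then show ?thesis using assms(1) homogeneous_iff_homogenize[of n f] by simp
qed

lemma ideal_power_irrelevant_subset:
  assumes "i \<ge> 1"
  shows "ideal_power irrelevant_ideal i \<subseteq> irrelevant_ideal"
proof -
  have "(\<Prod>k<i. f k) \<in> irrelevant_ideal" if "\<forall>k<i. f k \<in> irrelevant_ideal"
    for f :: "nat \<Rightarrow> 'a poly poly"
  proof -
    obtain j where "i = Suc j" using assms by (cases i) auto
    with that show ?thesis unfolding irrelevant_ideal_def by (simp add: ideal_generated_mult)
  qed
  then show ?thesis
    unfolding ideal_power_def irrelevant_ideal_def
    by (intro ideal_generated_minimal ideal_generated_0 ideal_generated_add ideal_generated_mult) auto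
qed

text \<open>An ideal containing a power of \<open>(s, t)\<close> agrees with \<open>(s, t)\<close>
  from that power on, so its saturation is the largest candidate, \<open>(s, t)\<close> itself. As
  all powers with positive exponent lie in \<open>(s, t)\<close>, agreement from \<open>i\<close>
  means that \<open>J\<close> contains the power \<open>i\<close>.\<close>

lemma saturation_degree_eq:
  assumes "n \<ge> 1" "ideal_power irrelevant_ideal n \<subseteq> J"
    and least: "\<And>i. 1 \<le> i \<Longrightarrow> i < n \<Longrightarrow> \<not> ideal_power irrelevant_ideal i \<subseteq> J"
  shows "saturation_degree J = n"
proof -
  have agrees: "agrees_from i irrelevant_ideal J \<longleftrightarrow> ideal_power irrelevant_ideal i \<subseteq> J"
    if "i \<ge> 1" for i
    using ideal_power_irrelevant_subset[OF that] unfolding agrees_from_def by blast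
  have "homogeneous_ideal (irrelevant_ideal :: 'a poly poly set)"
    unfolding homogeneous_ideal_def irrelevant_ideal_def
    by (rule exI[of _ "{var_s, var_t}"]) (use homogeneous_var_s homogeneous_var_t in auto)
  moreover have "\<exists>i\<ge>1. agrees_from i irrelevant_ideal J"
    using agrees[OF assms(1)] assms(1,2) by blast
  ultimately have "saturation J = irrelevant_ideal"
    unfolding saturation_def by (intro Greatest_equality) auto
  then have "saturation_degree J = (LEAST i. i \<ge> 1 \<and> agrees_from i irrelevant_ideal J)"
    by (simp add: saturation_degree_def)
  also have "\<dots> = n"
  proof (rule Least_equality)
    show "n \<ge> 1 \<and> agrees_from n irrelevant_ideal J" using agrees[OF assms(1)] assms(1,2) by blast
    show "n \<le> i" if "i \<ge> 1 \<and> agrees_from i irrelevant_ideal J" for i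
      using that agrees least[of i] not_less by blast
  qed
  finally show ?thesis .
qed

theorem saturation_degree_of_syzygies:
  fixes \<phi> P Q :: "3 \<Rightarrow> 'a::alg_closed_field poly poly"
  assumes hom: "\<And>i. homogeneous d (\<phi> i)" "\<And>i. homogeneous a (P i)" "\<And>i. homogeneous b (Q i)"
    and ab: "a + b = d" "a \<le> b" "b > 0"
    and syz: "(\<Sum>i\<in>UNIV. P i * \<phi> i) = 0" "(\<Sum>i\<in>UNIV. Q i * \<phi> i) = 0"
    and no_zero: "\<And>z. z \<in> line_cone \<Longrightarrow> \<exists>i. eval2 (\<phi> i) z \<noteq> 0"
    and indep: "\<And>\<alpha> \<beta>. (\<And>i. \<alpha> * eval2 (P i) (0, 1) + \<beta> * eval2 (Q i) (0, 1) = 0)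
      \<Longrightarrow> \<alpha> = 0 \<and> \<beta> = 0"
  shows "saturation_degree (ideal_generated (range \<phi>)) = b + d - 1"
proof -
  let ?f = "\<lambda>i. dehomogenize (\<phi> i)"
  let ?J = "ideal_generated (range \<phi>)"
  interpret syzygy_basis ?f "\<lambda>i. dehomogenize (P i)" "\<lambda>i. dehomogenize (Q i)" d a b
  proof
    show "(\<Sum>i\<in>UNIV. dehomogenize (P i) * dehomogenize (\<phi> i)) = 0"
      "(\<Sum>i\<in>UNIV. dehomogenize (Q i) * dehomogenize (\<phi> i)) = 0"
      using syz[THEN arg_cong[of _ _ dehomogenize]]
      by (simp_all add: dehomogenize_sum dehomogenize_mult dehomogenize_0)
    show "\<exists>i. poly (dehomogenize (\<phi> i)) y \<noteq> 0" for y
      using no_zero[of "(1, y)"] by (simp add: line_cone_def poly_dehomogenize)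
    show "\<exists>i. coeff (dehomogenize (\<phi> i)) d \<noteq> 0"
      using no_zero[of "(0, 1)"] by (simp add: line_cone_def eval2_0_homogeneous[OF hom(1)])
    show "\<alpha> = 0 \<and> \<beta> = 0"
      if "\<And>i. \<alpha> * coeff (dehomogenize (P i)) a + \<beta> * coeff (dehomogenize (Q i)) b = 0" for \<alpha> \<beta>
      using that indep[of \<alpha> \<beta>] by (simp add: eval2_0_homogeneous[OF hom(2)] eval2_0_homogeneous[OF hom(3)])
  qed (use ab hom in \<open>auto intro: degree_dehomogenize\<close>)
  \<comment> \<open>In these degrees the coefficient degree \<open>m = n - d\<close> satisfies
    \<open>b \<le> Suc m\<close>, as \<open>representable\<close> requires.\<close>
  have high: "h \<in> ?J" if h: "homogeneous n h" and "n \<ge> b + d - 1" for n h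
  proof -
    define m where "m = n - d"
    have m: "n = m + d" "b \<le> Suc m" using that ab unfolding m_def by linarith+
    obtain r where r: "\<And>i. degree (r i) \<le> m" "(\<Sum>i\<in>UNIV. r i * ?f i) = dehomogenize h"
      using representable[of "dehomogenize h" m] degree_dehomogenize[OF h] m by blast
    have "h = (\<Sum>i\<in>UNIV. homogenize m (r i) * \<phi> i)"
    proof (rule homogeneous_eqI)
      show "homogeneous n (\<Sum>i\<in>UNIV. homogenize m (r i) * \<phi> i)"
        unfolding m(1) by (intro homogeneous_sum homogeneous_mult homogeneous_homogenize hom)
      show "dehomogenize h = dehomogenize (\<Sum>i\<in>UNIV. homogenize m (r i) * \<phi> i)"
        using r by (simp add: dehomogenize_sum dehomogenize_mult dehomogenize_homogenize)
    qed (rule h)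
    then show ?thesis
      unfolding in_ideal_generated_range by (rule exI[of _ "\<lambda>i. homogenize m (r i)"])
  qed
  obtain h where h: "degree h + 2 \<le> b + d"
    and not_rep: "\<forall>r. (\<forall>i k. b \<le> Suc k \<longrightarrow> coeff (r i) k = 0) \<longrightarrow> (\<Sum>i\<in>UNIV. r i * ?f i) \<noteq> h"
    by (rule not_representable)
  define n where "n = b + d - 2"
  have n: "degree h \<le> n" "n + 2 = b + d" using h by (auto simp: n_def)
  have low: "homogenize n h \<notin> ?J"
  proof
    assume "homogenize n h \<in> ?J"
    then obtain R where R: "homogenize n h = (\<Sum>i\<in>UNIV. R i * \<phi> i)"
      unfolding in_ideal_generated_range by blast
    \<comment> \<open>Comparing components of degree \<open>n\<close> replaces the coefficients by
      forms of degree \<open>n - d = b - 2\<close>. If \<open>n < d\<close>, that is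
      \<open>b = 1\<close>, nothing of the right degree exists and they become 0.\<close>
    define R' where "R' i = (if d \<le> n then hom_part (n - d) (R i) else 0)" for i
    have "homogenize n h = hom_part n (homogenize n h)"
      using hom_part_homogeneous[OF homogeneous_homogenize] by metis
    also have "\<dots> = (\<Sum>i\<in>UNIV. R' i * \<phi> i)"
      unfolding R hom_part_sum R'_def
      by (intro sum.cong refl) (simp add: hom_part_mult[OF hom(1)] hom_part_mult_0[OF hom(1)])
    finally have "dehomogenize (homogenize n h) = (\<Sum>i\<in>UNIV. dehomogenize (R' i) * ?f i)"
      by (simp add: dehomogenize_sum dehomogenize_mult)
    then have "h = (\<Sum>i\<in>UNIV. dehomogenize (R' i) * ?f i)"
      using n by (simp add: dehomogenize_homogenize)
    moreover have "coeff (dehomogenize (R' i)) k = 0" if "b \<le> Suc k" for i k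
    proof (cases "d \<le> n")
      case True
      have "degree (dehomogenize (R' i)) \<le> n - d"
        unfolding R'_def using True by (simp add: degree_dehomogenize homogeneous_hom_part)
      with True n that show ?thesis by (intro coeff_eq_0) linarith
    next
      case False
      then show ?thesis by (simp add: R'_def dehomogenize_0)
    qed
    ultimately show False
      using not_rep[rule_format, of "\<lambda>i. dehomogenize (R' i)"] by blast
  qed
  show ?thesis
  proof (rule saturation_degree_eq)
    show "b + d - 1 \<ge> 1" using ab by linarith
    show "ideal_power irrelevant_ideal (b + d - 1) \<subseteq> ?J"
    proof
      fix f :: "'a poly poly" assume "f \<in> ideal_power irrelevant_ideal (b + d - 1)"
      then have ord: "f \<in> order_ge (b + d - 1)" using ideal_power_irrelevant_subset_order_ge by blast
      \<comment> \<open>Components below degree \<open>b + d - 1\<close> vanish by the order of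
        \<open>f\<close>; the others are covered by \<open>high\<close>.\<close>
      have "hom_part k f \<in> ?J" for k
      proof (cases "k \<ge> b + d - 1")
        case True
        then show ?thesis using high homogeneous_hom_part by blast
      next
        case False
        then have "hom_part k f = 0"
          using ord by (intro poly_eqI) (auto simp: coeff_hom_part order_ge_def)
        then show ?thesis by (simp add: ideal_generated_0)
      qed
      then show "f \<in> ?J" using sum_hom_part[of f] ideal_generated_sum by metis
    qed
    show "\<not> ideal_power irrelevant_ideal i \<subseteq> ?J" if "i < b + d - 1" for i
    proof -
      \<comment> \<open>The single form \<open>homogenize n h\<close> refutes all smaller exponents
        at once, since it lies in every power up to \<open>n\<close>.\<close>
      have "i \<le> n" using that n by linarith
      from homogeneous_in_ideal_power_irrelevant[OF homogeneous_homogenize this] low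
      show ?thesis by blast
    qed
  qed
qed

section \<open>Sections of the twisting sheaves\<close>

lemma zariski_open_subset: "zariski_open U \<Longrightarrow> U \<subseteq> line_cone"
  unfolding zariski_open_def by blast

lemma zariski_open_nonvanishing:
  assumes "homogeneous n e"
  shows "zariski_open {p \<in> line_cone. eval2 e p \<noteq> 0}"
  unfolding zariski_open_def using assms by (intro exI[of _ "{e}"]) auto

lemma zariski_open_basis:
  assumes "zariski_open U" "p \<in> U"
  obtains n e where "homogeneous n e" "eval2 e p \<noteq> 0"
    "\<And>q. q \<in> line_cone \<Longrightarrow> eval2 e q \<noteq> 0 \<Longrightarrow> q \<in> U"
  using assms unfolding zariski_open_def by blast

lemma zariski_openI:
  assumes "U \<subseteq> line_cone"
    and "\<And>p. p \<in> U \<Longrightarrow> \<exists>n e. homogeneous n e \<and> eval2 e p \<noteq> 0 \<and>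
      (\<forall>q\<in>line_cone. eval2 e q \<noteq> 0 \<longrightarrow> q \<in> U)"
  shows "zariski_open U"
  unfolding zariski_open_def
proof (intro exI conjI)
  let ?T = "{e. (\<exists>n. homogeneous n e) \<and> (\<forall>q\<in>line_cone. eval2 e q \<noteq> 0 \<longrightarrow> q \<in> U)}"
  show "\<forall>f\<in>?T. \<exists>n. homogeneous n f" by blast
  show "U = {p \<in> line_cone. \<exists>f\<in>?T. eval2 f p \<noteq> 0}"
  proof
    show "U \<subseteq> {p \<in> line_cone. \<exists>f\<in>?T. eval2 f p \<noteq> 0}"
    proof
      fix p assume "p \<in> U"
      with assms obtain n e where "homogeneous n e" "eval2 e p \<noteq> 0"
        "\<forall>q\<in>line_cone. eval2 e q \<noteq> 0 \<longrightarrow> q \<in> U" "p \<in> line_cone" by blast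
      then show "p \<in> {p \<in> line_cone. \<exists>f\<in>?T. eval2 f p \<noteq> 0}" by blast
    qed
  qed blast
qed

lemma zariski_open_Int:
  assumes "zariski_open U" "zariski_open V"
  shows "zariski_open (U \<inter> V)"
proof (rule zariski_openI)
  show "U \<inter> V \<subseteq> line_cone" using zariski_open_subset[OF assms(1)] by blast
  fix p assume p: "p \<in> U \<inter> V"
  obtain m e where e: "homogeneous m e" "eval2 e p \<noteq> 0"
    "\<And>q. q \<in> line_cone \<Longrightarrow> eval2 e q \<noteq> 0 \<Longrightarrow> q \<in> U"
    using zariski_open_basis[OF assms(1), of p] p by blast
  obtain n f where f: "homogeneous n f" "eval2 f p \<noteq> 0"
    "\<And>q. q \<in> line_cone \<Longrightarrow> eval2 f q \<noteq> 0 \<Longrightarrow> q \<in> V"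
    using zariski_open_basis[OF assms(2), of p] p by blast
  show "\<exists>n e. homogeneous n e \<and> eval2 e p \<noteq> 0 \<and> (\<forall>q\<in>line_cone. eval2 e q \<noteq> 0 \<longrightarrow> q \<in> U \<inter> V)"
    using homogeneous_mult[OF e(1) f(1)] e f
    by (intro exI[of _ "m + n"] exI[of _ "e * f"]) (auto simp: eval2_mult)
qed

lemma zariski_open_nonvanishing_Int:
  assumes "zariski_open U" "homogeneous n e"
  shows "zariski_open {p \<in> U. eval2 e p \<noteq> 0}"
proof -
  have "{p \<in> U. eval2 e p \<noteq> 0} = U \<inter> {p \<in> line_cone. eval2 e p \<noteq> 0}"
    using zariski_open_subset[OF assms(1)] by blast
  then show ?thesis
    using zariski_open_Int[OF assms(1) zariski_open_nonvanishing[OF assms(2)]] by simp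
qed

text \<open>Regularity of a section of \<open>O(n)\<close> at a point, without reference to an open
  set: the neighbourhood is the nonvanishing locus of the denominator. Clearing the denominator
  keeps sums and products of such fractions free of division.\<close>

definition regular_at :: "int \<Rightarrow> ('a::field \<times> 'a \<Rightarrow> 'a) \<Rightarrow> 'a \<times> 'a \<Rightarrow> bool" where
  "regular_at n h p \<longleftrightarrow> (\<exists>f g m k. homogeneous m f \<and> homogeneous k g \<and> int m - int k = n \<and>
     eval2 g p \<noteq> 0 \<and> (\<forall>q\<in>line_cone. eval2 g q \<noteq> 0 \<longrightarrow> h q * eval2 g q = eval2 f q))"

lemma regular_atI:
  assumes "homogeneous m f" "homogeneous k g" "int m - int k = n" "eval2 g p \<noteq> 0"
    "\<And>q. q \<in> line_cone \<Longrightarrow> eval2 g q \<noteq> 0 \<Longrightarrow> h q * eval2 g q = eval2 f q"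
  shows "regular_at n h p"
  using assms unfolding regular_at_def by blast

lemma regular_atE:
  assumes "regular_at n h p"
  obtains f g m k where "homogeneous m f" "homogeneous k g" "int m - int k = n" "eval2 g p \<noteq> 0"
    "\<And>q. q \<in> line_cone \<Longrightarrow> eval2 g q \<noteq> 0 \<Longrightarrow> h q * eval2 g q = eval2 f q"
  using assms unfolding regular_at_def by blast

lemma regular_at_form: "homogeneous m f \<Longrightarrow> regular_at (int m) (eval2 f) p"
  by (rule regular_atI[OF _ homogeneous_1]) (simp_all add: eval2_1)

lemma regular_at_add:
  assumes "regular_at n h p" "regular_at n h' p"
  shows "regular_at n (\<lambda>q. h q + h' q) p"
  using assms(1)
proof (rule regular_atE)
  fix f g m k
  assume fg: "homogeneous m f" "homogeneous k g" "int m - int k = n" "eval2 g p \<noteq> 0"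
    "\<And>q. q \<in> line_cone \<Longrightarrow> eval2 g q \<noteq> 0 \<Longrightarrow> h q * eval2 g q = eval2 f q"
  show ?thesis
    using assms(2)
  proof (rule regular_atE)
    fix f' g' m' k'
    assume fg': "homogeneous m' f'" "homogeneous k' g'" "int m' - int k' = n" "eval2 g' p \<noteq> 0"
      "\<And>q. q \<in> line_cone \<Longrightarrow> eval2 g' q \<noteq> 0 \<Longrightarrow> h' q * eval2 g' q = eval2 f' q"
    have "m' + k = m + k'" using fg(3) fg'(3) by linarith
    then have "homogeneous (m + k') (f * g' + f' * g)"
      using homogeneous_mult[OF fg(1) fg'(2)] homogeneous_mult[OF fg'(1) fg(2)]
      by (intro homogeneous_add) simp_all
    then show ?thesis
    proof (rule regular_atI[OF _ homogeneous_mult[OF fg(2) fg'(2)]])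
      show "int (m + k') - int (k + k') = n" using fg(3) by simp
      show "eval2 (g * g') p \<noteq> 0" using fg fg' by (simp add: eval2_mult)
      fix q assume q: "q \<in> line_cone" "eval2 (g * g') q \<noteq> 0"
      then have *: "eval2 f q = h q * eval2 g q" "eval2 f' q = h' q * eval2 g' q"
        using fg(5) fg'(5) by (simp_all add: eval2_mult)
      then show "(h q + h' q) * eval2 (g * g') q = eval2 (f * g' + f' * g) q"
        unfolding eval2_simps * by (simp add: algebra_simps)
    qed
  qed
qed

lemma regular_at_mult:
  assumes "regular_at n h p" "regular_at n' h' p"
  shows "regular_at (n + n') (\<lambda>q. h q * h' q) p"
  using assms(1)
proof (rule regular_atE)
  fix f g m k
  assume fg: "homogeneous m f" "homogeneous k g" "int m - int k = n" "eval2 g p \<noteq> 0"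
    "\<And>q. q \<in> line_cone \<Longrightarrow> eval2 g q \<noteq> 0 \<Longrightarrow> h q * eval2 g q = eval2 f q"
  show ?thesis
    using assms(2)
  proof (rule regular_atE)
    fix f' g' m' k'
    assume fg': "homogeneous m' f'" "homogeneous k' g'" "int m' - int k' = n'" "eval2 g' p \<noteq> 0"
      "\<And>q. q \<in> line_cone \<Longrightarrow> eval2 g' q \<noteq> 0 \<Longrightarrow> h' q * eval2 g' q = eval2 f' q"
    show ?thesis
    proof (rule regular_atI[OF homogeneous_mult[OF fg(1) fg'(1)] homogeneous_mult[OF fg(2) fg'(2)]])
      show "int (m + m') - int (k + k') = n + n'" using fg(3) fg'(3) by simp
      show "eval2 (g * g') p \<noteq> 0" using fg fg' by (simp add: eval2_mult)
      fix q assume q: "q \<in> line_cone" "eval2 (g * g') q \<noteq> 0"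
      then have *: "eval2 f q = h q * eval2 g q" "eval2 f' q = h' q * eval2 g' q"
        using fg(5) fg'(5) by (simp_all add: eval2_mult)
      then show "h q * h' q * eval2 (g * g') q = eval2 (f * f') q"
        unfolding eval2_simps * by (simp add: algebra_simps)
    qed
  qed
qed

lemma regular_at_inverse_form:
  assumes "homogeneous k e" "eval2 e p \<noteq> 0"
  shows "regular_at (- int k) (\<lambda>q. inverse (eval2 e q)) p"
  using assms by (intro regular_atI[OF homogeneous_1 assms(1)]) (simp_all add: eval2_1)

lemma regular_at_const: "regular_at 0 (\<lambda>q. c) p"
  using regular_at_form[OF homogeneous_const[of c], of p] by (simp add: eval2_const[abs_def])

lemma regular_at_uminus: "regular_at n h p \<Longrightarrow> regular_at n (\<lambda>q. - h q) p"
  using regular_at_mult[OF regular_at_const[of "- 1"]] by fastforce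

text \<open>Multiplying numerator and denominator by \<open>e\<close> shrinks the neighbourhood to
  one on which \<open>h'\<close> and \<open>h\<close> agree.\<close>

lemma regular_at_cong:
  assumes "regular_at n h p" "homogeneous r e" "eval2 e p \<noteq> 0"
    and cong: "\<And>q. q \<in> line_cone \<Longrightarrow> eval2 e q \<noteq> 0 \<Longrightarrow> h' q = h q"
  shows "regular_at n h' p"
  using assms(1)
proof (rule regular_atE)
  fix f g m k
  assume fg: "homogeneous m f" "homogeneous k g" "int m - int k = n" "eval2 g p \<noteq> 0"
    "\<And>q. q \<in> line_cone \<Longrightarrow> eval2 g q \<noteq> 0 \<Longrightarrow> h q * eval2 g q = eval2 f q"
  show ?thesis
    using fg assms
    by (intro regular_atI[OF homogeneous_mult[OF fg(1) assms(2)] homogeneous_mult[OF fg(2) assms(2)]])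
      (simp_all add: eval2_mult mult.assoc[symmetric])
qed

lemma regular_at_cong_open:
  assumes "regular_at n h p" "zariski_open U" "p \<in> U" "\<And>q. q \<in> U \<Longrightarrow> h' q = h q"
  shows "regular_at n h' p"
  using assms(2,3)
proof (rule zariski_open_basis)
  fix r e assume e: "homogeneous r e" "eval2 e p \<noteq> 0"
    "\<And>q. q \<in> line_cone \<Longrightarrow> eval2 e q \<noteq> 0 \<Longrightarrow> q \<in> U"
  show ?thesis by (rule regular_at_cong[OF assms(1) e(1,2)]) (use assms(4) e(3) in blast)
qed

text \<open>Any neighbourhood contains the nonvanishing locus of some form, which can be absorbed
  into the denominator. Conversely, the locus of the denominator intersected with \<open>U\<close>
  serves as \<open>V\<close>.\<close>

lemma twist_iff:
  assumes U: "zariski_open U"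
  shows "h \<in> twist n U \<longleftrightarrow> (\<forall>p. p \<notin> U \<longrightarrow> h p = 0) \<and> (\<forall>p\<in>U. regular_at n h p)"
proof -
  have "(\<exists>V f g m k. zariski_open V \<and> p \<in> V \<and> V \<subseteq> U \<and> homogeneous m f \<and> homogeneous k g \<and>
      int m - int k = n \<and> (\<forall>q\<in>V. eval2 g q \<noteq> 0 \<and> h q = eval2 f q / eval2 g q)) \<longleftrightarrow>
      regular_at n h p" (is "?L \<longleftrightarrow> ?R") if p: "p \<in> U" for p
  proof
    assume ?L
    then obtain V f g m k where V: "zariski_open V" "p \<in> V" "V \<subseteq> U"
      and fg: "homogeneous m f" "homogeneous k g" "int m - int k = n"
        "\<And>q. q \<in> V \<Longrightarrow> eval2 g q \<noteq> 0 \<and> h q = eval2 f q / eval2 g q" by blast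
    have "regular_at (int m + - int k) (\<lambda>q. eval2 f q * inverse (eval2 g q)) p"
      using fg V by (intro regular_at_mult regular_at_form regular_at_inverse_form) auto
    then have "regular_at n (\<lambda>q. eval2 f q * inverse (eval2 g q)) p" using fg(3) by simp
    then show ?R
    proof (rule regular_at_cong_open[OF _ V(1,2)])
      fix q assume "q \<in> V"
      from fg(4)[OF this] show "h q = eval2 f q * inverse (eval2 g q)"
        by (simp only: divide_inverse)
    qed
  next
    assume ?R
    then show ?L
    proof (rule regular_atE)
      fix f g m k
      assume fg: "homogeneous m f" "homogeneous k g" "int m - int k = n" "eval2 g p \<noteq> 0"
        "\<And>q. q \<in> line_cone \<Longrightarrow> eval2 g q \<noteq> 0 \<Longrightarrow> h q * eval2 g q = eval2 f q"
      have "\<forall>q\<in>{q \<in> U. eval2 g q \<noteq> 0}. eval2 g q \<noteq> 0 \<and> h q = eval2 f q / eval2 g q"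
        using fg(5) zariski_open_subset[OF U] by (auto simp: divide_simps)
      then show ?L
        using fg p zariski_open_nonvanishing_Int[OF U fg(2)]
        by (intro exI[of _ "{q \<in> U. eval2 g q \<noteq> 0}"] exI[of _ f] exI[of _ g] exI[of _ m]
            exI[of _ k]) auto
    qed
  qed
  then show ?thesis unfolding twist_def by blast
qed

text \<open>After multiplication by both denominators the difference vanishes at every
  \<open>(1, y)\<close>: either a denominator is zero there or both fractions equal
  \<open>h\<close>. The nonzero denominators then cancel.\<close>

lemma regular_representations_agree:
  fixes f g :: "'a::alg_closed_field poly poly"
  assumes fg: "\<And>q. q \<in> line_cone \<Longrightarrow> eval2 g q \<noteq> 0 \<Longrightarrow> h q * eval2 g q = eval2 f q"
    and fg': "\<And>q. q \<in> line_cone \<Longrightarrow> eval2 g' q \<noteq> 0 \<Longrightarrow> h q * eval2 g' q = eval2 f' q"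
    and "dehomogenize g \<noteq> 0" "dehomogenize g' \<noteq> 0"
  shows "dehomogenize f * dehomogenize g' = dehomogenize f' * dehomogenize g"
proof -
  let ?D = "dehomogenize f * dehomogenize g' - dehomogenize f' * dehomogenize g"
  have "?D * (dehomogenize g * dehomogenize g') = 0"
  proof (rule poly_ext_alg_closed)
    fix y :: 'a
    have "(1, y) \<in> line_cone" by (simp add: line_cone_def)
    then have "eval2 g (1, y) \<noteq> 0 \<Longrightarrow> eval2 f (1, y) = h (1, y) * eval2 g (1, y)"
      "eval2 g' (1, y) \<noteq> 0 \<Longrightarrow> eval2 f' (1, y) = h (1, y) * eval2 g' (1, y)"
      using fg fg' by simp_all
    then have "(eval2 f (1, y) * eval2 g' (1, y) - eval2 f' (1, y) * eval2 g (1, y)) *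
        (eval2 g (1, y) * eval2 g' (1, y)) = 0"
      by (cases "eval2 g (1, y) = 0 \<or> eval2 g' (1, y) = 0") auto
    then show "poly (?D * (dehomogenize g * dehomogenize g')) y = poly 0 y"
      by (simp add: poly_dehomogenize)
  qed
  with assms(3,4) show ?thesis by simp
qed

lemma dehomogenize_nonzero:
  fixes g :: "'a::alg_closed_field poly poly"
  assumes "homogeneous n g" "eval2 g p \<noteq> 0"
  shows "dehomogenize g \<noteq> 0"
  using homogeneous_eqI[OF assms(1) homogeneous_0] assms(2) by (auto simp: dehomogenize_0 eval2_0)

text \<open>A quotient of minimal denominator representing the section on the chart \<open>s = 1\<close> has a
  constant denominator, as a root of it could be cancelled; the local representation at the
  remaining point \<open>(0, 1)\<close> bounds the degree.\<close>

lemma globally_regular_is_form: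
  fixes h :: "'a::alg_closed_field \<times> 'a \<Rightarrow> 'a"
  assumes reg: "\<And>p. p \<in> line_cone \<Longrightarrow> regular_at (int n) h p"
  obtains F where "homogeneous n F" "\<And>p. p \<in> line_cone \<Longrightarrow> h p = eval2 F p"
proof -
  \<comment> \<open>\<open>R f g\<close> says that \<open>f / g\<close> represents \<open>h\<close>
    where \<open>g\<close> does not vanish. \<open>S v\<close> says that a single fraction
    \<open>u / v\<close> in the chart \<open>s = 1\<close> equals all these representations.\<close>
  define R where "R f g \<longleftrightarrow> (\<exists>k. homogeneous (k + n) f \<and> homogeneous k g) \<and> dehomogenize g \<noteq> 0 \<and>
    (\<forall>q\<in>line_cone. eval2 g q \<noteq> 0 \<longrightarrow> h q * eval2 g q = eval2 f q)" for f g
  define S where "S v \<longleftrightarrow> v \<noteq> 0 \<and> (\<exists>u. \<forall>f g. R f g \<longrightarrow>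
    u * dehomogenize g = dehomogenize f * v)" for v
  have ex_R: "\<exists>f g. R f g \<and> eval2 g p \<noteq> 0" if "p \<in> line_cone" for p
    using reg[OF that]
  proof (rule regular_atE)
    fix f g m k
    assume fg: "homogeneous m f" "homogeneous k g" "int m - int k = int n" "eval2 g p \<noteq> 0"
      "\<And>q. q \<in> line_cone \<Longrightarrow> eval2 g q \<noteq> 0 \<Longrightarrow> h q * eval2 g q = eval2 f q"
    moreover from this have "m = k + n" by linarith
    ultimately have "R f g" unfolding R_def using dehomogenize_nonzero by blast
    with fg(4) show ?thesis by blast
  qed
  obtain f0 g0 where R0: "R f0 g0"
    using ex_R[of "(1, 0)"] by (auto simp: line_cone_def)
  have "\<forall>f g. R f g \<longrightarrow> dehomogenize f0 * dehomogenize g = dehomogenize f * dehomogenize g0"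
    using R0 unfolding R_def by (intro allI impI regular_representations_agree[of _ h]) auto
  then have S0: "S (dehomogenize g0)"
    using R0 unfolding S_def R_def by blast
  define v where "v = arg_min degree S"
  have v: "S v" and min: "S v' \<Longrightarrow> degree v \<le> degree v'" for v'
    using arg_min_nat_lemma[of S _ degree, OF S0] unfolding v_def by blast+
  obtain u where u: "\<And>f g. R f g \<Longrightarrow> u * dehomogenize g = dehomogenize f * v"
    using v unfolding S_def by blast
  have "degree v = 0"
  proof (rule ccontr)
    assume "degree v \<noteq> 0"
    then obtain y where y: "poly v y = 0" using alg_closed_imp_poly_has_root by blast
    obtain f g where fg: "R f g" "eval2 g (1, y) \<noteq> 0"
      using ex_R[of "(1, y)"] by (auto simp: line_cone_def)
    have "poly (u * dehomogenize g) y = 0" unfolding u[OF fg(1)] using y by simp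
    with fg(2) have "poly u y = 0" by (simp add: poly_dehomogenize)
    with y obtain u' v' where uv: "u = [:- y, 1:] * u'" "v = [:- y, 1:] * v'"
      unfolding poly_eq_0_iff_dvd by (elim dvdE)
    have "v' \<noteq> 0" using v uv(2) unfolding S_def by auto
    moreover have "u' * dehomogenize g = dehomogenize f * v'" if "R f g" for f g
    proof -
      have "[:- y, 1:] * (u' * dehomogenize g) = [:- y, 1:] * (dehomogenize f * v')"
        using u[OF that] unfolding uv by (simp only: mult_ac)
      then show ?thesis by (subst (asm) mult_cancel_left) simp
    qed
    ultimately have "S v'" unfolding S_def by blast
    from min[OF this] have "degree v \<le> degree v'" .
    moreover have "degree v = Suc (degree v')"
      unfolding uv(2) using \<open>v' \<noteq> 0\<close> by (subst degree_mult_eq) auto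
    ultimately show False by simp
  qed
  then obtain c where c: "v = [:c:]" by (meson degree_eq_zeroE)
  with v have "c \<noteq> 0" unfolding S_def by auto
  define w where "w = smult (inverse c) u"
  have w: "w * dehomogenize g = dehomogenize f" if "R f g" for f g
    using u[OF that] \<open>c \<noteq> 0\<close> by (simp add: w_def c)
  have "degree w \<le> n"
  proof (cases "w = 0")
    case False
    obtain f g where fg: "R f g" "eval2 g (0, 1) \<noteq> 0"
      using ex_R[of "(0, 1)"] by (auto simp: line_cone_def)
    then obtain k where k: "homogeneous (k + n) f" "homogeneous k g" "dehomogenize g \<noteq> 0"
      unfolding R_def by blast
    have "k \<le> degree (dehomogenize g)"
      using fg(2) eval2_0_homogeneous[OF k(2), of 1] by (intro le_degree) simp
    then have "degree w + k \<le> degree (w * dehomogenize g)"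
      using False k(3) by (simp add: degree_mult_eq)
    also have "\<dots> \<le> k + n" using w[OF fg(1)] degree_dehomogenize[OF k(1)] by simp
    finally show ?thesis by simp
  qed simp
  show thesis
  proof
    show "homogeneous n (homogenize n w)" by (rule homogeneous_homogenize)
    fix p :: "'a \<times> 'a" assume p: "p \<in> line_cone"
    obtain f g where fg: "R f g" "eval2 g p \<noteq> 0" using ex_R[OF p] by blast
    then obtain k where k: "homogeneous (k + n) f" "homogeneous k g"
      unfolding R_def by blast
    have "homogenize n w * g = f"
    proof (rule homogeneous_eqI)
      show "homogeneous (k + n) (homogenize n w * g)"
        using homogeneous_mult[OF homogeneous_homogenize[of n w] k(2)] by (simp add: add.commute)
      show "dehomogenize (homogenize n w * g) = dehomogenize f"
        using w[OF fg(1)] \<open>degree w \<le> n\<close>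
        by (simp add: dehomogenize_mult dehomogenize_homogenize)
    qed (rule k)
    moreover have "h p * eval2 g p = eval2 f p" using fg p unfolding R_def by blast
    ultimately have "h p * eval2 g p = eval2 (homogenize n w) p * eval2 g p"
      by (metis eval2_mult)
    with fg(2) show "h p = eval2 (homogenize n w) p" by simp
  qed
qed

section \<open>The pullback of the twisted cotangent sheaf as a kernel\<close>

lemma poly_poly_eval2: "poly (poly f q) x = eval2 f (x, poly q x)"
  by (induction f) (simp_all add: eval2_def)

lemma linear_not_unit: "\<not> is_unit [:a, 1 :: 'a::idom_divide:]"
  by (auto simp: is_unit_poly_iff)

text \<open>A common zero yields a common linear factor: \<open>s\<close> if \<open>x = 0\<close>,
  and otherwise \<open>t - \<tau> s\<close> with \<open>\<tau> = y / x\<close>, by the factor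
  theorem for polynomials in \<open>t\<close> over \<open>K[s]\<close>.\<close>

lemma coprime_forms_no_common_zero:
  fixes \<phi> :: "'i \<Rightarrow> 'a::alg_closed_field poly poly"
  assumes hom: "\<And>i. homogeneous d (\<phi> i)" and "d > 0"
    and coprime: "\<forall>g. (\<forall>i. g dvd \<phi> i) \<longrightarrow> is_unit g"
    and z: "z \<in> line_cone"
  shows "\<exists>i. eval2 (\<phi> i) z \<noteq> 0"
proof (rule ccontr)
  assume "\<not> ?thesis"
  then have zero: "eval2 (\<phi> i) z = 0" for i by blast
  obtain x y where xy: "z = (x, y)" by fastforce
  show False
  proof (cases "x = 0")
    case True
    with z xy have "y \<noteq> 0" by (auto simp: line_cone_def)
    obtain n where n: "d = Suc n" using \<open>d > 0\<close> by (cases d) auto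
    have "var_s dvd \<phi> i" for i
    proof -
      have "eval2 (\<phi> i) (0, 1) = 0"
        using zero[of i] eval2_0_homogeneous[OF hom[of i]] \<open>y \<noteq> 0\<close> True xy by simp
      then show ?thesis using var_s_dvd_homogeneous[of n "\<phi> i"] hom n by (metis dvdI)
    qed
    then have "is_unit (var_s :: 'a poly poly)" using coprime by blast
    then show False using linear_not_unit[of "0 :: 'a"] by (auto simp: var_s_def is_unit_poly_iff)
  next
    case False
    define \<tau> where "\<tau> = y / x"
    have "[:- [:0, \<tau>:], 1:] dvd \<phi> i" for i
    proof -
      have "eval2 (\<phi> i) (x * 1, x * \<tau>) = 0" using zero[of i] False by (simp add: xy \<tau>_def)
      then have "eval2 (\<phi> i) (1, \<tau>) = 0" using False unfolding eval2_scale[OF hom] by simp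
      then have "eval2 (\<phi> i) (c * 1, c * \<tau>) = 0" for c unfolding eval2_scale[OF hom] by simp
      then have "poly (\<phi> i) [:0, \<tau>:] = 0"
        by (intro poly_ext_alg_closed) (simp add: poly_poly_eval2)
      then show ?thesis by (simp only: poly_eq_0_iff_dvd)
    qed
    then have "is_unit [:- [:0, \<tau>:], 1:]" using coprime by blast
    with linear_not_unit show False by blast
  qed
qed

text \<open>The zero section still needs a fraction of degree \<open>n\<close>. For negative
  \<open>n\<close> the denominator is a power of a coordinate that does not vanish at
  \<open>p\<close>.\<close>

lemma regular_at_0:
  assumes "p \<in> line_cone"
  shows "regular_at n (\<lambda>q. 0) p"
proof (cases "n \<ge> 0")
  case True
  then show ?thesis
    by (intro regular_atI[OF homogeneous_0[of "nat n"] homogeneous_1]) (simp_all add: eval2_1 eval2_0)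
next
  case False
  obtain l :: "'a poly poly" where l: "homogeneous 1 l" "eval2 l p \<noteq> 0"
  proof (cases "fst p = 0")
    case True
    with assms show thesis
      by (intro that[OF homogeneous_var_t]) (auto simp: eval2_var_t line_cone_def prod_eq_iff)
  qed (use that[OF homogeneous_var_s] in \<open>auto simp: eval2_var_s\<close>)
  have hom: "homogeneous (nat (- n)) (l ^ nat (- n))"
    using homogeneous_power[OF l(1), of "nat (- n)"] by simp
  with False l(2) show ?thesis
    by (intro regular_atI[OF homogeneous_0[of 0] hom]) (simp_all add: eval2_power eval2_0)
qed

text \<open>For forms of degree \<open>d\<close> these are the sections over \<open>U\<close> of the
  kernel of \<open>\<phi>\<close> from \<open>O^3\<close> to \<open>O(d)\<close>. Unlike sections of
  a presheaf, \<open>G\<close> is arbitrary outside \<open>U\<close>.\<close>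

definition kernel_section ::
  "(3 \<Rightarrow> 'a::field poly poly) \<Rightarrow> ('a \<times> 'a) set \<Rightarrow> (3 \<Rightarrow> 'a \<times> 'a \<Rightarrow> 'a) \<Rightarrow> bool" where
  "kernel_section \<phi> U G \<longleftrightarrow> (\<forall>p\<in>U. (\<Sum>k\<in>UNIV. eval2 (\<phi> k) p * G k p) = 0) \<and>
     (\<forall>p\<in>U. \<forall>k. regular_at 0 (G k) p)"

text \<open>By the Euler sequence \<open>\<Omega>(1)\<close> is the kernel of \<open>(x0, x1, x2) : \<O>\<^sup>3 \<rightarrow> \<O>(1)\<close>, where
  \<open>x i \<otimes> d(x k / x i)\<close> corresponds to \<open>e k - (x k / x i) e i\<close>. The coefficients of a kernel
  vector \<open>G\<close> on the chart \<open>x i \<noteq> 0\<close> are thus its components \<open>G k\<close> with \<open>k \<noteq> i\<close>.\<close>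

definition of_kernel ::
  "(3 \<Rightarrow> 'a::field poly poly) \<Rightarrow> ('a \<times> 'a) set \<Rightarrow> (3 \<Rightarrow> 'a \<times> 'a \<Rightarrow> 'a) \<Rightarrow> 3 \<times> 3 \<Rightarrow> 'a \<times> 'a \<Rightarrow> 'a"
  where
  "of_kernel \<phi> U G = (\<lambda>(i, k) p. if p \<in> U \<and> eval2 (\<phi> i) p \<noteq> 0 \<and> k \<noteq> i then G k p else 0)"

lemma of_kernel_cong:
  assumes "\<And>p k. p \<in> U \<Longrightarrow> G k p = G' k p"
  shows "of_kernel \<phi> U G = of_kernel \<phi> U G'"
  using assms by (auto simp: of_kernel_def fun_eq_iff)

lemma restr_of_kernel: "V \<subseteq> U \<Longrightarrow> restr V (of_kernel \<phi> U G) = of_kernel \<phi> V G"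
  by (auto simp: restr_def of_kernel_def fun_eq_iff)

lemma of_kernel_add:
  "of_kernel \<phi> U (\<lambda>k p. G k p + G' k p) = (\<lambda>i p. of_kernel \<phi> U G i p + of_kernel \<phi> U G' i p)"
  by (auto simp: of_kernel_def fun_eq_iff)

lemma of_kernel_mult:
  "of_kernel \<phi> U (\<lambda>k p. h p * G k p) = (\<lambda>i p. h p * of_kernel \<phi> U G i p)"
  by (auto simp: of_kernel_def fun_eq_iff)

lemma kernel_section_subset: "kernel_section \<phi> U G \<Longrightarrow> V \<subseteq> U \<Longrightarrow> kernel_section \<phi> V G"
  unfolding kernel_section_def by blast

lemma kernel_section_mult:
  assumes "kernel_section \<phi> U G" "\<And>p. p \<in> U \<Longrightarrow> regular_at 0 h p"
  shows "kernel_section \<phi> U (\<lambda>k p. h p * G k p)"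
proof -
  have "(\<Sum>k\<in>UNIV. eval2 (\<phi> k) p * (h p * G k p)) = h p * (\<Sum>k\<in>UNIV. eval2 (\<phi> k) p * G k p)" for p
    by (simp add: sum_distrib_left mult.left_commute)
  with assms regular_at_mult[of 0 h _ 0] show ?thesis unfolding kernel_section_def by simp
qed

lemma sum_diff_3: "(\<Sum>k\<in>UNIV - {i}. f k) = f (i + 1) + f (i + (2 :: 3))"
proof -
  have "UNIV - {i} = {i + 1, i + 2}" using UNIV_3_rotate[of i] distinct_3_rotate[of i] by auto
  then show ?thesis using distinct_3_rotate[of i] by simp
qed

text \<open>The factors \<open>x i / x j\<close> and \<open>x j / x i\<close> cancel, so a component
  other than \<open>i\<close> passes unchanged from chart \<open>i\<close> to chart
  \<open>j\<close>.\<close>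

lemma twisted_cotangent_transition_other:
  assumes "x i \<noteq> 0" "x j \<noteq> 0" "l \<noteq> i"
  shows "(\<Sum>k\<in>UNIV - {i}. twisted_cotangent_transition i j k l x * w k) = w l"
proof -
  have "(\<Sum>k\<in>UNIV - {i}. twisted_cotangent_transition i j k l x * w k) =
      (\<Sum>k\<in>UNIV - {i}. if k = l then w k else 0)"
    using assms by (intro sum.cong)
      (auto simp: twisted_cotangent_transition_def cotangent_transition_def)
  then show ?thesis using assms by simp
qed

text \<open>The result is the component \<open>i\<close> that orthogonality to \<open>x\<close>
  forces. Chart changes thus become the identity on kernel vectors.\<close>

lemma twisted_cotangent_transition_same:
  assumes "x i \<noteq> 0" "x j \<noteq> 0"
  shows "(\<Sum>k\<in>UNIV - {i}. twisted_cotangent_transition i j k i x * w k) =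
    - (\<Sum>k\<in>UNIV - {i}. x k * w k) / x i"
proof -
  have "(\<Sum>k\<in>UNIV - {i}. twisted_cotangent_transition i j k i x * w k) =
      (\<Sum>k\<in>UNIV - {i}. - (x k * w k / x i))"
    using assms by (intro sum.cong)
      (auto simp: twisted_cotangent_transition_def cotangent_transition_def power2_eq_square)
  then show ?thesis by (simp add: sum_negf sum_divide_distrib)
qed

lemma of_kernel_in_pullback:
  assumes U: "zariski_open U" and hom: "\<And>i. homogeneous d (\<phi> i)"
    and G: "kernel_section \<phi> U G"
  shows "of_kernel \<phi> U G \<in> pullback_twisted_cotangent \<phi> U"
  unfolding pullback_twisted_cotangent_def mem_Collect_eq
proof (intro conjI allI impI ballI)
  fix i show "of_kernel \<phi> U G (i, i) = (\<lambda>p. 0)" by (simp add: of_kernel_def)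
next
  fix i k :: 3 assume "k \<noteq> i"
  let ?V = "{p \<in> U. param_map \<phi> p i \<noteq> 0}"
  have V: "zariski_open ?V"
    unfolding param_map_def by (rule zariski_open_nonvanishing_Int[OF U hom])
  show "of_kernel \<phi> U G (i, k) \<in> twist 0 ?V"
    unfolding twist_iff[OF V]
  proof (intro conjI allI impI ballI)
    show "of_kernel \<phi> U G (i, k) p = 0" if "p \<notin> ?V" for p
      using that by (auto simp: of_kernel_def param_map_def)
    fix p assume p: "p \<in> ?V"
    then have "regular_at 0 (G k) p" using G unfolding kernel_section_def by blast
    from this V p show "regular_at 0 (of_kernel \<phi> U G (i, k)) p"
      by (rule regular_at_cong_open) (use \<open>k \<noteq> i\<close> in \<open>auto simp: of_kernel_def param_map_def\<close>)
  qed
next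
  fix i j l p
  assume p: "p \<in> U" and *: "l \<noteq> j \<and> param_map \<phi> p i \<noteq> 0 \<and> param_map \<phi> p j \<noteq> 0"
  let ?x = "param_map \<phi> p"
  have "(\<Sum>k\<in>UNIV - {i}. twisted_cotangent_transition i j k l ?x * of_kernel \<phi> U G (i, k) p) =
      (\<Sum>k\<in>UNIV - {i}. twisted_cotangent_transition i j k l ?x * G k p)"
    using p * by (intro sum.cong) (auto simp: of_kernel_def param_map_def)
  also have "\<dots> = G l p"
  proof (cases "l = i")
    case True
    \<comment> \<open>The component \<open>i\<close>, absent from chart \<open>i\<close>, is
      recovered from the kernel relation.\<close>
    have "?x i * G i p + (\<Sum>k\<in>UNIV - {i}. ?x k * G k p) = (\<Sum>k\<in>UNIV. ?x k * G k p)"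
      by (rule sum.remove[symmetric]) simp_all
    also have "\<dots> = 0" using G p by (simp add: kernel_section_def param_map_def)
    finally have "- (\<Sum>k\<in>UNIV - {i}. ?x k * G k p) = ?x i * G i p"
      by (metis minus_unique add.commute)
    then have "- (\<Sum>k\<in>UNIV - {i}. ?x k * G k p) / ?x i = G i p" using * by simp
    with * show ?thesis
      unfolding True using twisted_cotangent_transition_same[of ?x i j "\<lambda>k. G k p"] by simp
  next
    case False
    with * show ?thesis by (intro twisted_cotangent_transition_other) auto
  qed
  also have "\<dots> = of_kernel \<phi> U G (j, l) p" using p * by (simp add: of_kernel_def param_map_def)
  finally show "of_kernel \<phi> U G (j, l) p =
    (\<Sum>k\<in>UNIV - {i}. twisted_cotangent_transition i j k l ?x * of_kernel \<phi> U G (i, k) p)" ..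
qed

text \<open>On each chart the missing component is solved from the kernel relation. The gluing
  conditions say that the resulting vectors \<open>C i\<close> agree on overlaps, so they define one
  kernel section.\<close>

lemma pullback_of_kernelE:
  assumes U: "zariski_open U" and hom: "\<And>i. homogeneous d (\<phi> i)"
    and no_zero: "\<And>p. p \<in> line_cone \<Longrightarrow> \<exists>i. eval2 (\<phi> i) p \<noteq> 0"
    and w: "w \<in> pullback_twisted_cotangent \<phi> U"
  obtains G where "kernel_section \<phi> U G" "w = of_kernel \<phi> U G"
proof -
  let ?x = "param_map \<phi>"
  have w_diag: "w (i, i) = (\<lambda>p. 0)" for i
    using w unfolding pullback_twisted_cotangent_def by blast
  have V: "zariski_open {p \<in> U. ?x p i \<noteq> 0}" for i
    unfolding param_map_def by (rule zariski_open_nonvanishing_Int[OF U hom])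
  have w_twist: "w (i, k) \<in> twist 0 {p \<in> U. ?x p i \<noteq> 0}" if "k \<noteq> i" for i k
    using w that unfolding pullback_twisted_cotangent_def by blast
  have trans: "w (j, l) p = (\<Sum>k\<in>UNIV - {i}. twisted_cotangent_transition i j k l (?x p) * w (i, k) p)"
    if "p \<in> U" "l \<noteq> j" "?x p i \<noteq> 0" "?x p j \<noteq> 0" for i j l p
    using w that unfolding pullback_twisted_cotangent_def by blast
  define C where "C i k p = (if k = i then - (\<Sum>l\<in>UNIV - {i}. ?x p l * w (i, l) p) / ?x p i
    else w (i, k) p)" for i k p
  have C_eq: "C i k p = C j k p" if p: "p \<in> U" "?x p i \<noteq> 0" "?x p j \<noteq> 0" for i j k p
  proof -
    have *: "C i l p = w (j, l) p" if "l \<noteq> j" for l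
    proof (cases "l = i")
      case True
      then show ?thesis
        using trans[OF p(1) that p(2,3)] twisted_cotangent_transition_same[of "?x p" i j] p
        by (simp add: C_def)
    next
      case False
      then show ?thesis
        using trans[OF p(1) that p(2,3)] twisted_cotangent_transition_other[of "?x p" i j l] p
        by (simp add: C_def)
    qed
    have rel: "(\<Sum>k\<in>UNIV. ?x p k * C i k p) = 0" if "?x p i \<noteq> 0" for i
      using that by (subst sum.remove[of _ i]) (simp_all add: C_def)
    show ?thesis
    proof (cases "k = j")
      case True
      \<comment> \<open>Chart \<open>j\<close> does not record the component \<open>j\<close>; the
        kernel relation for \<open>C i\<close> determines it from the components already
        compared.\<close>
      have "?x p j * C i j p + (\<Sum>k\<in>UNIV - {j}. ?x p k * C i k p) = 0"
        using rel[OF p(2)] by (subst (asm) sum.remove[of _ j]) simp_all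
      moreover have "(\<Sum>k\<in>UNIV - {j}. ?x p k * C i k p) = (\<Sum>k\<in>UNIV - {j}. ?x p k * w (j, k) p)"
        using * by (intro sum.cong) auto
      ultimately have "?x p j * C i j p = - (\<Sum>k\<in>UNIV - {j}. ?x p k * w (j, k) p)"
        by (simp add: eq_neg_iff_add_eq_0)
      then have "C i j p = - (\<Sum>k\<in>UNIV - {j}. ?x p k * w (j, k) p) / ?x p j"
        using p(3) by (metis nonzero_mult_div_cancel_left)
      then show ?thesis unfolding True by (simp add: C_def)
    next
      case False
      then show ?thesis using * by (simp add: C_def)
    qed
  qed
  \<comment> \<open>By \<open>C_eq\<close> every chart containing \<open>p\<close> gives the same
    value, so an arbitrary choice is consistent.\<close>
  define G where "G k p = C (SOME i. ?x p i \<noteq> 0) k p" for k p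
  have G_eq: "G k p = C i k p" if "p \<in> U" "?x p i \<noteq> 0" for i k p
    unfolding G_def using that someI[of "\<lambda>i. ?x p i \<noteq> 0" i] by (intro C_eq) auto
  have chart: "\<exists>i. ?x p i \<noteq> 0" if "p \<in> U" for p
    using that no_zero zariski_open_subset[OF U] unfolding param_map_def by blast
  have "regular_at 0 (G k) p" if p: "p \<in> U" for p k
  proof -
    obtain i where i: "?x p i \<noteq> 0" using chart[OF p] by blast
    have reg_w: "regular_at 0 (w (i, l)) p" if "l \<noteq> i" for l
      using w_twist[OF that] p i unfolding twist_iff[OF V] by blast
    have reg_x: "regular_at (int d) (\<lambda>p. ?x p l) p" for l
      using regular_at_form[OF hom] unfolding param_map_def .
    have reg_inv: "regular_at (- int d) (\<lambda>p. inverse (?x p i)) p"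
      using regular_at_inverse_form[OF hom] i unfolding param_map_def .
    have "regular_at 0 (C i k) p"
    proof (cases "k = i")
      case True
      have "regular_at (int d + 0) (\<lambda>p. \<Sum>l\<in>UNIV - {i}. ?x p l * w (i, l) p) p"
        unfolding sum_diff_3 using distinct_3_rotate[of i]
        by (intro regular_at_add regular_at_mult reg_x reg_w)
      from regular_at_mult[OF regular_at_uminus[OF this] reg_inv]
      have "regular_at 0 (\<lambda>p. - (\<Sum>l\<in>UNIV - {i}. ?x p l * w (i, l) p) * inverse (?x p i)) p" by simp
      then show ?thesis unfolding C_def True by (simp add: divide_inverse)
    next
      case False
      then show ?thesis unfolding C_def using reg_w by simp
    qed
    from this V show ?thesis
      by (rule regular_at_cong_open) (use p i G_eq in auto)
  qed
  moreover have "(\<Sum>k\<in>UNIV. eval2 (\<phi> k) p * G k p) = 0" if p: "p \<in> U" for p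
  proof -
    obtain i where i: "?x p i \<noteq> 0" using chart[OF p] by blast
    have "(\<Sum>k\<in>UNIV. ?x p k * C i k p) = 0"
      using i by (subst sum.remove[of _ i]) (simp_all add: C_def)
    then show ?thesis using G_eq[OF p i] by (simp add: param_map_def)
  qed
  ultimately have "kernel_section \<phi> U G" unfolding kernel_section_def by blast
  moreover have "w = of_kernel \<phi> U G"
  proof (intro ext)
    fix ik :: "3 \<times> 3" and p
    obtain i k where ik: "ik = (i, k)" by fastforce
    show "w ik p = of_kernel \<phi> U G ik p"
    proof (cases "k = i")
      case True
      then show ?thesis by (simp add: ik of_kernel_def w_diag)
    next
      case False
      show ?thesis
      proof (cases "p \<in> {p \<in> U. ?x p i \<noteq> 0}")
        case True
        then show ?thesis using G_eq[of p i k] False by (simp add: ik of_kernel_def C_def param_map_def)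
      next
        case notin: False
        then have "w (i, k) p = 0" using w_twist[OF False] unfolding twist_def by blast
        then show ?thesis using notin by (auto simp: ik of_kernel_def param_map_def)
      qed
    qed
  qed
  ultimately show thesis by (rule that)
qed

text \<open>Over chart \<open>i\<close> all components but \<open>i\<close> are recorded, and the
  kernel relation determines that one because \<open>\<phi> i\<close> does not vanish at
  \<open>p\<close>.\<close>

lemma of_kernel_inj:
  assumes "kernel_section \<phi> U G" "kernel_section \<phi> U G'" "of_kernel \<phi> U G = of_kernel \<phi> U G'"
    and p: "p \<in> U" and i: "eval2 (\<phi> i) p \<noteq> 0"
  shows "G k p = G' k p"
proof -
  have *: "G l p = G' l p" if "l \<noteq> i" for l
    using fun_cong[OF fun_cong[OF assms(3), of "(i, l)"], of p] p i that by (simp add: of_kernel_def)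
  have "(\<Sum>k\<in>UNIV. eval2 (\<phi> k) p * G k p) = (\<Sum>k\<in>UNIV. eval2 (\<phi> k) p * G' k p)"
    using assms(1,2) p by (simp add: kernel_section_def)
  then have "eval2 (\<phi> i) p * G i p = eval2 (\<phi> i) p * G' i p"
    using *[OF distinct_3_rotate(1)] *[OF distinct_3_rotate(2)] by (simp add: sum_3[of _ i])
  with i * show ?thesis by (cases "k = i") auto
qed

section \<open>From a splitting isomorphism to two syzygies\<close>

locale split_pullback =
  fixes \<phi> :: "3 \<Rightarrow> 'a::alg_closed_field poly poly" and d a b :: nat
    and \<Phi> :: "('a \<times> 'a) set \<Rightarrow> (3 \<times> 3 \<Rightarrow> 'a \<times> 'a \<Rightarrow> 'a) \<Rightarrow> bool \<Rightarrow> 'a \<times> 'a \<Rightarrow> 'a"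
  assumes hom: "\<And>i. homogeneous d (\<phi> i)"
    and no_zero: "\<And>p. p \<in> line_cone \<Longrightarrow> \<exists>i. eval2 (\<phi> i) p \<noteq> 0"
    and iso: "sheaf_isomorphism (pullback_twisted_cotangent \<phi>) (twist_sum (- int a) (- int b)) \<Phi>"
    and ab: "a \<le> b" "b > 0"
begin

abbreviation "E \<equiv> pullback_twisted_cotangent \<phi>"
abbreviation "F \<equiv> twist_sum (- int a) (- int b)"

lemma iso_bij: "zariski_open U \<Longrightarrow> bij_betw (\<Phi> U) (E U) (F U)"
  and iso_add: "zariski_open U \<Longrightarrow> x \<in> E U \<Longrightarrow> y \<in> E U \<Longrightarrow>
    \<Phi> U (\<lambda>i p. x i p + y i p) = (\<lambda>j p. \<Phi> U x j p + \<Phi> U y j p)"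
  and iso_mult: "zariski_open U \<Longrightarrow> h \<in> twist 0 U \<Longrightarrow> x \<in> E U \<Longrightarrow>
    \<Phi> U (\<lambda>i p. h p * x i p) = (\<lambda>j p. h p * \<Phi> U x j p)"
  and iso_restr: "zariski_open U \<Longrightarrow> zariski_open V \<Longrightarrow> V \<subseteq> U \<Longrightarrow> x \<in> E U \<Longrightarrow>
    \<Phi> V (restr V x) = restr V (\<Phi> U x)"
  using iso unfolding sheaf_isomorphism_def by blast+

text \<open>Elements of \<open>twist 0 U\<close> are zero outside \<open>U\<close>, hence the
  truncated multiplier; \<open>of_kernel\<close> does not see the truncation.\<close>

lemma iso_mult_kernel:
  assumes U: "zariski_open U" and h: "\<And>p. p \<in> U \<Longrightarrow> regular_at 0 h p"
    and G: "kernel_section \<phi> U G"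
  shows "\<Phi> U (of_kernel \<phi> U (\<lambda>k p. h p * G k p)) =
    (\<lambda>j p. (if p \<in> U then h p else 0) * \<Phi> U (of_kernel \<phi> U G) j p)"
proof -
  let ?h = "\<lambda>p. if p \<in> U then h p else 0"
  have "?h \<in> twist 0 U"
    unfolding twist_iff[OF U]
  proof (intro conjI allI impI ballI)
    fix p assume p: "p \<in> U"
    from h[OF p] U p show "regular_at 0 ?h p" by (rule regular_at_cong_open) simp
  qed simp
  from iso_mult[OF U this of_kernel_in_pullback[OF U hom G]]
  show ?thesis using of_kernel_cong[of U "\<lambda>k p. h p * G k p" "\<lambda>k p. ?h p * G k p" \<phi>]
    by (simp add: of_kernel_mult)
qed

definition deg :: "bool \<Rightarrow> nat" where "deg \<beta> = (if \<beta> then b else a)"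

definition chart :: "'a poly poly \<Rightarrow> ('a \<times> 'a) set" where
  "chart L = {p \<in> line_cone. eval2 L p \<noteq> 0}"

text \<open>The power \<open>- deg \<beta>\<close> of a linear form \<open>L\<close> generates the
  summand \<open>O(- deg \<beta>)\<close> over the chart of \<open>L\<close>. \<open>False\<close>
  stands for the summand of \<open>a\<close>, \<open>True\<close> for that of
  \<open>b\<close>.\<close>

definition basis_section :: "bool \<Rightarrow> 'a poly poly \<Rightarrow> bool \<Rightarrow> 'a \<times> 'a \<Rightarrow> 'a" where
  "basis_section \<beta> L \<gamma> p = (if \<gamma> = \<beta> \<and> p \<in> chart L then inverse (eval2 L p ^ deg \<beta>) else 0)"

lemma chart_open: "homogeneous 1 L \<Longrightarrow> zariski_open (chart L)"
  unfolding chart_def by (rule zariski_open_nonvanishing)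

lemma regular_at_inverse_power:
  assumes "homogeneous 1 L" "eval2 L p \<noteq> 0"
  shows "regular_at (- int n) (\<lambda>q. inverse (eval2 L q ^ n)) p"
  using regular_at_inverse_form[of n "L ^ n" p] homogeneous_power[OF assms(1), of n] assms(2)
  by (simp add: eval2_power)

lemma regular_at_power:
  assumes "homogeneous 1 L"
  shows "regular_at (int n) (\<lambda>q. eval2 L q ^ n) p"
  using regular_at_form[of n "L ^ n" p] homogeneous_power[OF assms(1), of n]
  by (simp add: eval2_power[abs_def])

lemma basis_section_in_twist_sum:
  assumes L: "homogeneous 1 L"
  shows "basis_section \<beta> L \<in> F (chart L)"
proof -
  have "basis_section \<beta> L \<gamma> \<in> twist (- int (deg \<gamma>)) (chart L)" for \<gamma>
    unfolding twist_iff[OF chart_open[OF L]]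
  proof (intro conjI allI impI ballI)
    show "basis_section \<beta> L \<gamma> p = 0" if "p \<notin> chart L" for p
      using that by (simp add: basis_section_def)
    fix p assume p: "p \<in> chart L"
    show "regular_at (- int (deg \<gamma>)) (basis_section \<beta> L \<gamma>) p"
    proof (cases "\<gamma> = \<beta>")
      case True
      from p have "eval2 L p \<noteq> 0" by (simp add: chart_def)
      from regular_at_inverse_power[OF L this] chart_open[OF L] p show ?thesis
        by (rule regular_at_cong_open) (simp add: basis_section_def True)
    next
      case False
      then have "basis_section \<beta> L \<gamma> = (\<lambda>q. 0)" by (auto simp: basis_section_def)
      with p show ?thesis by (simp add: regular_at_0 chart_def)
    qed
  qed
  from this[of False] this[of True] show ?thesis by (simp add: twist_sum_def deg_def)
qed

lemma basis_section_lift: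
  assumes L: "homogeneous 1 L"
  obtains G where "kernel_section \<phi> (chart L) G"
    "\<Phi> (chart L) (of_kernel \<phi> (chart L) G) = basis_section \<beta> L"
proof -
  note U = chart_open[OF L]
  have "basis_section \<beta> L \<in> \<Phi> (chart L) ` E (chart L)"
    unfolding bij_betw_imp_surj_on[OF iso_bij[OF U]] by (rule basis_section_in_twist_sum[OF L])
  then obtain w where w: "w \<in> E (chart L)" "\<Phi> (chart L) w = basis_section \<beta> L"
    by (metis imageE)
  obtain G where "kernel_section \<phi> (chart L) G" "w = of_kernel \<phi> (chart L) G"
    using pullback_of_kernelE[OF U hom no_zero w(1)] by blast
  with w(2) show thesis by (intro that) simp_all
qed

text \<open>On the overlap the generators differ by the regular function \<open>h\<close>, the power
  \<open>deg \<beta>\<close> of \<open>M / L\<close>. Linearity and injectivity of the isomorphism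
  transfer this to the preimages, so their multiples by powers of \<open>L\<close> and
  \<open>M\<close> glue.\<close>

lemma basis_lifts_compatible:
  assumes L: "homogeneous 1 L" and M: "homogeneous 1 M"
    and G: "kernel_section \<phi> (chart L) G"
      "\<Phi> (chart L) (of_kernel \<phi> (chart L) G) = basis_section \<beta> L"
    and H: "kernel_section \<phi> (chart M) H"
      "\<Phi> (chart M) (of_kernel \<phi> (chart M) H) = basis_section \<beta> M"
    and p: "p \<in> chart L" "p \<in> chart M"
  shows "eval2 L p ^ deg \<beta> * G k p = eval2 M p ^ deg \<beta> * H k p"
proof -
  define V where "V = chart L \<inter> chart M"
  let ?n = "deg \<beta>"
  note UL = chart_open[OF L] and UM = chart_open[OF M]
  have V: "zariski_open V" "V \<subseteq> chart L" "V \<subseteq> chart M"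
    unfolding V_def using zariski_open_Int[OF UL UM] by auto
  define h where "h q = eval2 M q ^ ?n * inverse (eval2 L q ^ ?n)" for q
  have h: "regular_at 0 h q" if "q \<in> V" for q
  proof -
    have "eval2 L q \<noteq> 0" using that V by (auto simp: chart_def)
    from regular_at_mult[OF regular_at_power[OF M] regular_at_inverse_power[OF L this], of ?n ?n]
    show ?thesis by (simp add: h_def[abs_def])
  qed
  have GV: "kernel_section \<phi> V G" and HV: "kernel_section \<phi> V H"
    using kernel_section_subset G(1) H(1) V by blast+
  have hHV: "kernel_section \<phi> V (\<lambda>k q. h q * H k q)"
    using kernel_section_mult[OF HV h] .
  have \<Phi>G: "\<Phi> V (of_kernel \<phi> V G) = restr V (basis_section \<beta> L)"
    using iso_restr[OF UL V(1,2) of_kernel_in_pullback[OF UL hom G(1)]]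
    by (simp add: restr_of_kernel[OF V(2)] G(2))
  have "\<Phi> V (of_kernel \<phi> V H) = restr V (basis_section \<beta> M)"
    using iso_restr[OF UM V(1,3) of_kernel_in_pullback[OF UM hom H(1)]]
    by (simp add: restr_of_kernel[OF V(3)] H(2))
  then have "\<Phi> V (of_kernel \<phi> V (\<lambda>k q. h q * H k q)) =
      (\<lambda>j q. (if q \<in> V then h q else 0) * restr V (basis_section \<beta> M) j q)"
    using iso_mult_kernel[OF V(1) h HV] by simp
  also have "\<dots> = restr V (basis_section \<beta> L)"
    using V(2,3) by (auto simp: fun_eq_iff restr_def basis_section_def h_def chart_def)
  finally have "\<Phi> V (of_kernel \<phi> V (\<lambda>k q. h q * H k q)) = restr V (basis_section \<beta> L)" .
  with \<Phi>G have "of_kernel \<phi> V G = of_kernel \<phi> V (\<lambda>k q. h q * H k q)"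
    by (intro inj_onD[OF bij_betw_imp_inj_on[OF iso_bij[OF V(1)]]]
        of_kernel_in_pullback[OF V(1) hom GV] of_kernel_in_pullback[OF V(1) hom hHV]) simp
  moreover obtain i where "eval2 (\<phi> i) p \<noteq> 0" using no_zero[of p] p unfolding chart_def by blast
  moreover have "p \<in> V" using p by (simp add: V_def)
  ultimately have "G k p = h p * H k p" using of_kernel_inj[OF GV hHV] by blast
  moreover have "eval2 L p \<noteq> 0" using p by (simp add: chart_def)
  ultimately show ?thesis by (simp add: h_def)
qed

lemma syzygy_of_vanishing:
  assumes "\<And>k. homogeneous n (P k)"
    and zero: "\<And>p. p \<in> line_cone \<Longrightarrow> (\<Sum>k\<in>UNIV. eval2 (\<phi> k) p * eval2 (P k) p) = 0"
  shows "(\<Sum>k\<in>UNIV. P k * \<phi> k) = 0"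
proof (rule homogeneous_eqI)
  show "homogeneous (n + d) (\<Sum>k\<in>UNIV. P k * \<phi> k)"
    by (intro homogeneous_sum homogeneous_mult assms hom)
  show "dehomogenize (\<Sum>k\<in>UNIV. P k * \<phi> k) = dehomogenize 0"
  proof (rule poly_ext_alg_closed)
    fix y :: 'a
    show "poly (dehomogenize (\<Sum>k\<in>UNIV. P k * \<phi> k)) y = poly (dehomogenize 0) y"
      using zero[of "(1, y)"]
      by (simp add: poly_dehomogenize eval2_simps line_cone_def mult.commute)
  qed
qed (rule homogeneous_0)

text \<open>The preimages of the generators over \<open>s \<noteq> 0\<close> and
  \<open>t \<noteq> 0\<close>, multiplied by powers of \<open>s\<close> and \<open>t\<close>, glue
  to global sections of \<open>O(deg \<beta>)\<close>, which are forms. The last two clauses keep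
  the link to \<open>\<Phi>\<close> around \<open>(0, 1)\<close>, where independence is
  tested.\<close>

lemma basis_syzygy:
  obtains P where "\<And>k. homogeneous (deg \<beta>) (P k)" "(\<Sum>k\<in>UNIV. P k * \<phi> k) = 0"
    "kernel_section \<phi> (chart var_t) (\<lambda>k p. inverse (snd p ^ deg \<beta>) * eval2 (P k) p)"
    "\<Phi> (chart var_t) (of_kernel \<phi> (chart var_t) (\<lambda>k p. inverse (snd p ^ deg \<beta>) * eval2 (P k) p))
      = basis_section \<beta> var_t"
proof -
  let ?n = "deg \<beta>"
  note s = homogeneous_var_s and t = homogeneous_var_t
  obtain G where G: "kernel_section \<phi> (chart var_s) G"
    "\<Phi> (chart var_s) (of_kernel \<phi> (chart var_s) G) = basis_section \<beta> var_s"
    using basis_section_lift[OF s] by blast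
  obtain H where H: "kernel_section \<phi> (chart var_t) H"
    "\<Phi> (chart var_t) (of_kernel \<phi> (chart var_t) H) = basis_section \<beta> var_t"
    using basis_section_lift[OF t] by blast
  define K where "K k p = (if p \<in> chart var_s then fst p ^ ?n * G k p else snd p ^ ?n * H k p)" for k p
  have K_s: "K k p = eval2 var_s p ^ ?n * G k p" if "p \<in> chart var_s" for k p
    using that by (simp add: K_def eval2_var_s)
  have K_t: "K k p = eval2 var_t p ^ ?n * H k p" if "p \<in> chart var_t" for k p
    using that basis_lifts_compatible[OF s t G H, of p k] by (simp add: K_def eval2_var_s eval2_var_t)
  have cover: "p \<in> chart var_s \<or> p \<in> chart var_t" if "p \<in> line_cone" for p
    using that by (auto simp: chart_def line_cone_def eval2_var_s eval2_var_t prod_eq_iff)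
  have reg_K: "regular_at (int ?n) (K k) p" if "p \<in> line_cone" for k p
    using cover[OF that]
  proof
    assume p: "p \<in> chart var_s"
    then have "regular_at 0 (G k) p" using G(1) unfolding kernel_section_def by blast
    from regular_at_mult[OF regular_at_power[OF s] this]
    have "regular_at (int ?n) (\<lambda>p. eval2 var_s p ^ ?n * G k p) p" by simp
    from this chart_open[OF s] p show ?thesis by (rule regular_at_cong_open) (rule K_s)
  next
    assume p: "p \<in> chart var_t"
    then have "regular_at 0 (H k) p" using H(1) unfolding kernel_section_def by blast
    from regular_at_mult[OF regular_at_power[OF t] this]
    have "regular_at (int ?n) (\<lambda>p. eval2 var_t p ^ ?n * H k p) p" by simp
    from this chart_open[OF t] p show ?thesis by (rule regular_at_cong_open) (rule K_t)
  qed
  have "\<exists>F. homogeneous ?n F \<and> (\<forall>p\<in>line_cone. K k p = eval2 F p)" for k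
    using globally_regular_is_form[OF reg_K] by metis
  then obtain P where P: "\<And>k. homogeneous ?n (P k)" "\<And>k p. p \<in> line_cone \<Longrightarrow> K k p = eval2 (P k) p"
    by metis
  have "(\<Sum>k\<in>UNIV. eval2 (\<phi> k) p * eval2 (P k) p) = 0" if p: "p \<in> line_cone" for p
    using cover[OF p]
  proof
    assume q: "p \<in> chart var_s"
    have "(\<Sum>k\<in>UNIV. eval2 (\<phi> k) p * eval2 (P k) p) =
        eval2 var_s p ^ ?n * (\<Sum>k\<in>UNIV. eval2 (\<phi> k) p * G k p)"
      unfolding P(2)[OF p, symmetric] K_s[OF q] sum_distrib_left by (simp add: mult_ac)
    then show ?thesis using G(1) q unfolding kernel_section_def by simp
  next
    assume q: "p \<in> chart var_t"
    have "(\<Sum>k\<in>UNIV. eval2 (\<phi> k) p * eval2 (P k) p) =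
        eval2 var_t p ^ ?n * (\<Sum>k\<in>UNIV. eval2 (\<phi> k) p * H k p)"
      unfolding P(2)[OF p, symmetric] K_t[OF q] sum_distrib_left by (simp add: mult_ac)
    then show ?thesis using H(1) q unfolding kernel_section_def by simp
  qed
  then have syz: "(\<Sum>k\<in>UNIV. P k * \<phi> k) = 0" using syzygy_of_vanishing P(1) by blast
  have H_eq: "H k p = inverse (snd p ^ ?n) * eval2 (P k) p" if "p \<in> chart var_t" for k p
  proof -
    have "snd p \<noteq> 0" "p \<in> line_cone" using that by (auto simp: chart_def eval2_var_t)
    then show ?thesis using P(2)[of p k] K_t[OF that, of k] by (simp add: eval2_var_t field_simps)
  qed
  show thesis
  proof (rule that[OF P(1) syz])
    show "kernel_section \<phi> (chart var_t) (\<lambda>k p. inverse (snd p ^ ?n) * eval2 (P k) p)"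
      unfolding kernel_section_def
    proof (intro conjI ballI allI)
      fix p assume p: "p \<in> chart var_t"
      show "(\<Sum>k\<in>UNIV. eval2 (\<phi> k) p * (inverse (snd p ^ ?n) * eval2 (P k) p)) = 0"
        using H(1) p by (simp add: kernel_section_def flip: H_eq)
      fix k
      have "regular_at 0 (H k) p" using H(1) p unfolding kernel_section_def by blast
      from this chart_open[OF t] p
      show "regular_at 0 (\<lambda>p. inverse (snd p ^ ?n) * eval2 (P k) p) p"
        by (rule regular_at_cong_open) (simp add: H_eq)
    qed
    show "\<Phi> (chart var_t) (of_kernel \<phi> (chart var_t) (\<lambda>k p. inverse (snd p ^ ?n) * eval2 (P k) p))
      = basis_section \<beta> var_t"
      using H(2) of_kernel_cong[of "chart var_t" H, OF H_eq] by metis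
  qed
qed

text \<open>A dependence at \<open>(0, 1)\<close> makes a combination of the two basis sections over
  \<open>t \<noteq> 0\<close> divisible by \<open>s / t\<close>. The isomorphism preserves this, but
  the images are the generators of the two summands, and their combination vanishes at
  \<open>(0, 1)\<close> only if both coefficients are zero.\<close>

lemma independent_syzygies:
  obtains P Q where "\<And>k. homogeneous a (P k)" "\<And>k. homogeneous b (Q k)"
    "(\<Sum>k\<in>UNIV. P k * \<phi> k) = 0" "(\<Sum>k\<in>UNIV. Q k * \<phi> k) = 0"
    "\<forall>\<alpha> \<beta>. (\<forall>k. \<alpha> * eval2 (P k) (0, 1) + \<beta> * eval2 (Q k) (0, 1) = 0) \<longrightarrow> \<alpha> = 0 \<and> \<beta> = 0"
proof -
  let ?U = "chart var_t"
  note t = homogeneous_var_t and U = chart_open[OF homogeneous_var_t]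
  let ?G = "\<lambda>P n k p. inverse (snd p ^ n) * eval2 (P k) p"
  obtain P where P: "\<And>k. homogeneous a (P k)" "(\<Sum>k\<in>UNIV. P k * \<phi> k) = 0"
    "kernel_section \<phi> ?U (?G P a)" "\<Phi> ?U (of_kernel \<phi> ?U (?G P a)) = basis_section False var_t"
    using basis_syzygy[of False] unfolding deg_def if_False by blast
  obtain Q where Q: "\<And>k. homogeneous b (Q k)" "(\<Sum>k\<in>UNIV. Q k * \<phi> k) = 0"
    "kernel_section \<phi> ?U (?G Q b)" "\<Phi> ?U (of_kernel \<phi> ?U (?G Q b)) = basis_section True var_t"
    using basis_syzygy[of True] unfolding deg_def if_True by blast
  have "\<alpha> = 0 \<and> \<beta> = 0"
    if dep: "\<forall>k. \<alpha> * eval2 (P k) (0, 1) + \<beta> * eval2 (Q k) (0, 1) = 0" for \<alpha> \<beta>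
  proof -
    \<comment> \<open>The power \<open>b - a\<close> of \<open>t\<close> equalizes the degrees and
      takes the value 1 at \<open>(0, 1)\<close>.\<close>
    define R where "R k = [:[:\<alpha>:]:] * var_t ^ (b - a) * P k + [:[:\<beta>:]:] * Q k" for k
    obtain m where m: "b = Suc m" using ab by (cases b) auto
    have R: "homogeneous b (R k)" for k
    proof -
      have "homogeneous (0 + (b - a) * 1 + a) ([:[:\<alpha>:]:] * var_t ^ (b - a) * P k)"
        by (intro homogeneous_mult homogeneous_power homogeneous_const t P)
      then have "homogeneous b ([:[:\<alpha>:]:] * var_t ^ (b - a) * P k)" using ab by simp
      moreover have "homogeneous (0 + b) ([:[:\<beta>:]:] * Q k)"
        by (intro homogeneous_mult homogeneous_const Q)
      ultimately show ?thesis unfolding R_def by (intro homogeneous_add) simp_all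
    qed
    have "eval2 (R k) (0, 1) = 0" for k
      using dep unfolding R_def eval2_simps by simp
    then have "\<exists>S. homogeneous m S \<and> R k = var_s * S" for k
      using var_s_dvd_homogeneous[of m "R k"] R[of k] m by metis
    then obtain S where S: "\<And>k. homogeneous m (S k)" "\<And>k. R k = var_s * S k" by metis
    have "var_s * (\<Sum>k\<in>UNIV. S k * \<phi> k) = (\<Sum>k\<in>UNIV. R k * \<phi> k)"
      by (simp add: S(2) sum_distrib_left mult.assoc)
    also have "\<dots> = [:[:\<alpha>:]:] * var_t ^ (b - a) * (\<Sum>k\<in>UNIV. P k * \<phi> k)
        + [:[:\<beta>:]:] * (\<Sum>k\<in>UNIV. Q k * \<phi> k)"
      unfolding R_def by (simp only: sum_distrib_left distrib_right sum.distrib mult.assoc)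
    finally have "var_s * (\<Sum>k\<in>UNIV. S k * \<phi> k) = 0" unfolding P(2) Q(2) by simp
    moreover have "(var_s :: 'a poly poly) \<noteq> 0" by (simp add: var_s_def)
    ultimately have syz_S: "(\<Sum>k\<in>UNIV. S k * \<phi> k) = 0" by (metis mult_eq_0_iff)
    have t_nz: "snd p \<noteq> 0" "eval2 var_t p \<noteq> 0" if "p \<in> ?U" for p
      using that by (auto simp: chart_def eval2_var_t)
    have ker_S: "kernel_section \<phi> ?U (?G S m)"
      unfolding kernel_section_def
    proof (intro conjI ballI allI)
      fix p assume p: "p \<in> ?U"
      have "(\<Sum>k\<in>UNIV. eval2 (\<phi> k) p * ?G S m k p) =
          inverse (snd p ^ m) * eval2 (\<Sum>k\<in>UNIV. S k * \<phi> k) p"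
        by (simp add: eval2_simps sum_distrib_left mult_ac)
      then show "(\<Sum>k\<in>UNIV. eval2 (\<phi> k) p * ?G S m k p) = 0" by (simp add: syz_S eval2_0)
      fix k
      show "regular_at 0 (?G S m k) p"
        using regular_at_mult[OF regular_at_inverse_power[OF t t_nz(2)[OF p], of m] regular_at_form[OF S(1)]]
        by (simp add: eval2_var_t)
    qed
    \<comment> \<open>\<open>h = s / t\<close> carries the zero at \<open>(0, 1)\<close>; the
      remaining factor is the section given by the syzygy \<open>S\<close> of degree
      \<open>m = b - 1\<close>.\<close>
    define h :: "'a \<times> 'a \<Rightarrow> 'a" where "h p = eval2 var_s p * inverse (eval2 var_t p)" for p
    have h: "regular_at 0 h p" if "p \<in> ?U" for p
      using regular_at_mult[OF regular_at_form[OF homogeneous_var_s] regular_at_inverse_form[OF t t_nz(2)[OF that]]]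
      by (simp add: h_def[abs_def])
    have eq: "\<alpha> * ?G P a k p + \<beta> * ?G Q b k p = h p * ?G S m k p" if "p \<in> ?U" for k p
    proof -
      have "eval2 (R k) p = fst p * eval2 (S k) p" by (simp add: S(2) eval2_simps)
      then have 1: "\<alpha> * snd p ^ (b - a) * eval2 (P k) p + \<beta> * eval2 (Q k) p = fst p * eval2 (S k) p"
        unfolding R_def eval2_simps by simp
      have 2: "inverse (snd p ^ a) = inverse (snd p ^ b) * snd p ^ (b - a)"
        using t_nz(1)[OF that] ab(1) by (simp add: power_diff field_simps)
      have "\<alpha> * ?G P a k p + \<beta> * ?G Q b k p =
          inverse (snd p ^ b) * (\<alpha> * snd p ^ (b - a) * eval2 (P k) p + \<beta> * eval2 (Q k) p)"
        unfolding 2 by (simp only: distrib_left mult_ac)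
      also have "\<dots> = h p * ?G S m k p"
        unfolding 1 h_def eval2_simps by (simp add: m mult_ac)
      finally show ?thesis .
    qed
    have hS: "\<Phi> ?U (of_kernel \<phi> ?U (\<lambda>k p. h p * ?G S m k p)) =
        (\<lambda>j p. (if p \<in> ?U then h p else 0) * \<Phi> ?U (of_kernel \<phi> ?U (?G S m)) j p)"
      by (rule iso_mult_kernel[OF U h ker_S])
    have c: "regular_at 0 (\<lambda>q. c) p" for c :: 'a and p by (rule regular_at_const)
    have "of_kernel \<phi> ?U (\<lambda>k p. h p * ?G S m k p) =
        of_kernel \<phi> ?U (\<lambda>k p. \<alpha> * ?G P a k p + \<beta> * ?G Q b k p)"
      by (rule of_kernel_cong) (simp only: eq)
    also have "\<dots> = (\<lambda>i p. of_kernel \<phi> ?U (\<lambda>k p. \<alpha> * ?G P a k p) i p + of_kernel \<phi> ?U (\<lambda>k p. \<beta> * ?G Q b k p) i p)"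
      by (rule of_kernel_add)
    finally have "\<Phi> ?U (of_kernel \<phi> ?U (\<lambda>k p. h p * ?G S m k p)) =
        (\<lambda>j p. \<Phi> ?U (of_kernel \<phi> ?U (\<lambda>k p. \<alpha> * ?G P a k p)) j p
          + \<Phi> ?U (of_kernel \<phi> ?U (\<lambda>k p. \<beta> * ?G Q b k p)) j p)"
      using iso_add[OF U of_kernel_in_pullback[OF U hom kernel_section_mult[OF P(3) c]]
          of_kernel_in_pullback[OF U hom kernel_section_mult[OF Q(3) c]]] by simp
    then have "(\<lambda>j p. (if p \<in> ?U then h p else 0) * \<Phi> ?U (of_kernel \<phi> ?U (?G S m)) j p) =
        (\<lambda>j p. (if p \<in> ?U then \<alpha> else 0) * basis_section False var_t j p
          + (if p \<in> ?U then \<beta> else 0) * basis_section True var_t j p)"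
      unfolding iso_mult_kernel[OF U c P(3)] iso_mult_kernel[OF U c Q(3)] P(4) Q(4)
      by (rule trans[OF hS[symmetric]])
    then have *: "(if p \<in> ?U then h p else 0) * \<Phi> ?U (of_kernel \<phi> ?U (?G S m)) j p =
        (if p \<in> ?U then \<alpha> else 0) * basis_section False var_t j p
        + (if p \<in> ?U then \<beta> else 0) * basis_section True var_t j p" for j p
      by (rule fun_cong[OF fun_cong])
    have p0: "(0, 1) \<in> ?U" by (simp add: chart_def line_cone_def eval2_var_t)
    \<comment> \<open>At \<open>(0, 1)\<close> the left-hand side of \<open>*\<close> vanishes,
      while its components \<open>False\<close> and \<open>True\<close> read off
      \<open>\<alpha>\<close> and \<open>\<beta>\<close> on the right.\<close>
    have "h (0, 1) = 0" by (simp add: h_def eval2_var_s)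
    with *[of "(0, 1)" False] *[of "(0, 1)" True] p0 show ?thesis
      by (simp add: basis_section_def eval2_var_t)
  qed
  then show thesis using that[OF P(1) Q(1) P(2) Q(2)] by blast
qed

end

section \<open>Curves contained in a line\<close>

text \<open>A polynomial function with expansion \<open>A + B * \<epsilon>\<close> up to higher
  powers. The sum and product rules for such expansions relate formal partial derivatives to
  directional derivatives in every characteristic.\<close>

definition first_order :: "('a::comm_ring_1 \<Rightarrow> 'a) \<Rightarrow> 'a \<Rightarrow> 'a \<Rightarrow> bool" where
  "first_order f A B \<longleftrightarrow> (\<exists>q. (\<forall>\<epsilon>. f \<epsilon> = poly q \<epsilon>) \<and> coeff q 0 = A \<and> coeff q 1 = B)"

lemma first_order_const: "first_order (\<lambda>\<epsilon>. c) c 0"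
  unfolding first_order_def by (rule exI[of _ "[:c:]"]) simp

lemma first_order_linear: "first_order (\<lambda>\<epsilon>. x + \<epsilon> * v) x v"
  unfolding first_order_def by (rule exI[of _ "[:x, v:]"]) simp

lemma first_order_add:
  assumes "first_order f A B" "first_order g C D"
  shows "first_order (\<lambda>\<epsilon>. f \<epsilon> + g \<epsilon>) (A + C) (B + D)"
proof -
  obtain q r where "\<forall>\<epsilon>. f \<epsilon> = poly q \<epsilon>" "coeff q 0 = A" "coeff q 1 = B"
    "\<forall>\<epsilon>. g \<epsilon> = poly r \<epsilon>" "coeff r 0 = C" "coeff r 1 = D"
    using assms unfolding first_order_def by blast
  then show ?thesis unfolding first_order_def by (intro exI[of _ "q + r"]) simp
qed

lemma first_order_mult:
  assumes "first_order f A B" "first_order g C D"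
  shows "first_order (\<lambda>\<epsilon>. f \<epsilon> * g \<epsilon>) (A * C) (A * D + B * C)"
proof -
  obtain q r where "\<forall>\<epsilon>. f \<epsilon> = poly q \<epsilon>" "coeff q 0 = A" "coeff q 1 = B"
    "\<forall>\<epsilon>. g \<epsilon> = poly r \<epsilon>" "coeff r 0 = C" "coeff r 1 = D"
    using assms unfolding first_order_def by blast
  then show ?thesis unfolding first_order_def
    by (intro exI[of _ "q * r"]) (simp add: coeff_mult)
qed

lemma first_order_poly:
  "first_order (\<lambda>\<epsilon>. poly f (x + \<epsilon> * v)) (poly f x) (poly (pderiv f) x * v)"
proof (induction f)
  case 0
  show ?case using first_order_const[of 0] by simp
next
  case (pCons c f)
  from first_order_add[OF first_order_const[of c] first_order_mult[OF first_order_linear[of x v] pCons.IH]]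
  show ?case by (simp add: pderiv_pCons algebra_simps)
qed

lemma eval2_pCons: "eval2 (pCons c f) p = poly c (fst p) + snd p * eval2 f p"
  by (simp add: eval2_def)

lemma partial_s_pCons: "partial_s (pCons c f) = pCons (pderiv c) (partial_s f)"
  unfolding partial_s_def by (rule map_poly_pCons) simp

lemma partial_t_pCons: "partial_t (pCons c f) = f + pCons 0 (partial_t f)"
  unfolding partial_t_def by (rule pderiv_pCons)

lemma first_order_eval2:
  "first_order (\<lambda>\<epsilon>. eval2 f (x + \<epsilon> * u, y + \<epsilon> * v)) (eval2 f (x, y))
    (eval2 (partial_s f) (x, y) * u + eval2 (partial_t f) (x, y) * v)"
proof (induction f)
  case 0
  show ?case using first_order_const[of 0] by (simp add: eval2_0 partial_s_def partial_t_def)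
next
  case (pCons c f)
  from first_order_add[OF first_order_poly[of c x u]
      first_order_mult[OF first_order_linear[of y v] pCons.IH]]
  show ?case by (simp add: eval2_pCons partial_s_pCons partial_t_pCons eval2_add algebra_simps)
qed

lemma eval3_pCons: "eval3 (pCons c F) x = eval2 c (x 0, x 1) + x 2 * eval3 F x"
  by (simp add: eval3_def eval2_def)

lemma eval3_add: "eval3 (F + G) x = eval3 F x + eval3 G x"
  by (simp add: eval3_def)

lemma partial3_pCons:
  "partial3 0 (pCons c F) = pCons (partial_s c) (partial3 0 F)"
  "partial3 1 (pCons c F) = pCons (partial_t c) (partial3 1 F)"
  "partial3 2 (pCons c F) = F + pCons 0 (partial3 2 F)"
proof -
  show "partial3 0 (pCons c F) = pCons (partial_s c) (partial3 0 F)"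
    unfolding partial3_def partial_s_def by (simp add: map_poly_pCons)
  show "partial3 1 (pCons c F) = pCons (partial_t c) (partial3 1 F)"
    unfolding partial3_def partial_t_def by (simp add: map_poly_pCons)
  show "partial3 2 (pCons c F) = F + pCons 0 (partial3 2 F)"
    unfolding partial3_def by (simp add: pderiv_pCons)
qed

text \<open>The chain rule along a line, by Horner's scheme in \<open>x2\<close>, with the
  two-variable case for the coefficients.\<close>

lemma first_order_eval3:
  "first_order (\<lambda>\<epsilon>. eval3 F (\<lambda>i. x i + \<epsilon> * v i)) (eval3 F x)
    (\<Sum>i\<in>UNIV. eval3 (partial3 i F) x * v i)"
proof (induction F)
  case 0
  show ?case using first_order_const[of 0] by (simp add: eval3_def partial3_def sum_3[of _ 0])
next
  case (pCons c F)
  from first_order_add[OF first_order_eval2[of c "x 0" "v 0" "x 1" "v 1"]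
      first_order_mult[OF first_order_linear[of "x 2" "v 2"] pCons.IH]]
  show ?case
    by (simp add: sum_3[of _ 0] eval3_pCons eval3_add partial3_pCons eval2_0 algebra_simps)
qed

lemma first_order_zero:
  fixes f :: "'a::idom \<Rightarrow> 'a"
  assumes "first_order f A B" "infinite {\<epsilon>. f \<epsilon> = 0}"
  shows "B = 0"
proof -
  obtain q where q: "\<forall>\<epsilon>. f \<epsilon> = poly q \<epsilon>" "coeff q 1 = B"
    using assms(1) unfolding first_order_def by blast
  have "q = 0" by (rule poly_eqI_infinite) (use assms(2) q(1) in simp)
  with q(2) show ?thesis by simp
qed

section \<open>A curve contained in the line with coefficients \<open>l\<close>\<close>

locale curve_in_line =
  fixes \<phi> :: "3 \<Rightarrow> 'a::alg_closed_field poly poly" and d :: nat and l :: "3 \<Rightarrow> 'a" and k :: 3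
  assumes hom: "\<And>i. homogeneous d (\<phi> i)" and d: "d \<ge> 2"
    and no_zero: "\<And>p. p \<in> line_cone \<Longrightarrow> \<exists>i. eval2 (\<phi> i) p \<noteq> 0"
    and rel: "\<And>p. (\<Sum>i\<in>UNIV. l i * eval2 (\<phi> i) p) = 0" and lk: "l k \<noteq> 0"
begin

definition H :: "(3 \<Rightarrow> 'a) set" where "H = {x. (\<Sum>i\<in>UNIV. l i * x i) = 0}"

text \<open>As \<open>l k\<close> is nonzero, \<open>k + 1\<close> and \<open>k + 2\<close> give
  coordinates on the plane \<open>H\<close>. In these \<open>det\<close> is the determinant, so on
  \<open>H\<close> it detects linear dependence.\<close>

definition det :: "(3 \<Rightarrow> 'a) \<Rightarrow> (3 \<Rightarrow> 'a) \<Rightarrow> 'a" where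
  "det x y = x (k + 1) * y (k + 2) - x (k + 2) * y (k + 1)"

lemma H_iff: "x \<in> H \<longleftrightarrow> l k * x k = - (l (k + 1) * x (k + 1) + l (k + 2) * x (k + 2))"
  unfolding H_def sum_3[of _ k] mem_Collect_eq add.assoc eq_neg_iff_add_eq_0 ..

lemma param_in_H: "param_map \<phi> p \<in> H"
  using rel by (simp add: H_def param_map_def)

lemma det_zero_parallel:
  assumes "x \<in> H" "y \<in> H" "det x y = 0" "x \<noteq> (\<lambda>_. 0)"
  shows "\<exists>c. \<forall>i. y i = c * x i"
proof -
  have "x (k + 1) \<noteq> 0 \<or> x (k + 2) \<noteq> 0"
  proof (rule ccontr)
    assume *: "\<not> ?thesis"
    then have "x k = 0" using assms(1) lk unfolding H_iff by simp
    with * have "x j = 0" for j by (cases j k rule: exhaust_3) simp_all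
    with assms(4) show False by blast
  qed
  then obtain c where c: "y (k + 1) = c * x (k + 1)" "y (k + 2) = c * x (k + 2)"
  proof
    assume "x (k + 1) \<noteq> 0"
    with assms(3) show thesis
      by (intro that[of "y (k + 1) / x (k + 1)"]) (simp_all add: det_def field_simps)
  next
    assume "x (k + 2) \<noteq> 0"
    with assms(3) show thesis
      by (intro that[of "y (k + 2) / x (k + 2)"]) (simp_all add: det_def field_simps)
  qed
  have "l k * y k = c * - (l (k + 1) * x (k + 1) + l (k + 2) * x (k + 2))"
    using assms(2) unfolding H_iff c by (simp add: algebra_simps)
  also have "\<dots> = l k * (c * x k)"
    using assms(1) unfolding H_iff by (metis mult.left_commute)
  finally have "y k = c * x k" using lk by simp
  with c have "y i = c * x i" for i by (cases i k rule: exhaust_3) simp_all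
  then show ?thesis by blast
qed

lemma det_param_zero:
  assumes "z \<in> line_cone" "y \<in> H" "y \<noteq> (\<lambda>_. 0)" "det y (param_map \<phi> z) = 0"
  shows "same_point3 (param_map \<phi> z) y"
proof -
  have "det (param_map \<phi> z) y = - det y (param_map \<phi> z)" by (simp add: det_def)
  then have "det (param_map \<phi> z) y = 0" using assms(4) by simp
  moreover have "param_map \<phi> z \<noteq> (\<lambda>_. 0)"
    using no_zero[OF assms(1)] by (auto simp: param_map_def fun_eq_iff)
  ultimately have "\<exists>c. \<forall>i. y i = c * param_map \<phi> z i"
    by (rule det_zero_parallel[OF param_in_H assms(2)])
  then obtain c where c: "\<And>i. y i = c * param_map \<phi> z i" by blast
  moreover have "c \<noteq> 0"
  proof
    assume "c = 0"
    with c have "y = (\<lambda>_. 0)" by (intro ext) simp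
    with assms(3) show False by blast
  qed
  ultimately show ?thesis unfolding same_point3_def by blast
qed

text \<open>The pullback along \<open>\<phi>\<close> of the linear form \<open>det y\<close>. For
  nonzero \<open>y\<close> in \<open>H\<close> its zeros are the points mapped to the point
  \<open>y\<close>.\<close>

definition pencil :: "(3 \<Rightarrow> 'a) \<Rightarrow> 'a poly poly" where
  "pencil y = [:[:y (k + 1):]:] * \<phi> (k + 2) - [:[:y (k + 2):]:] * \<phi> (k + 1)"

lemma homogeneous_pencil: "homogeneous d (pencil y)"
proof -
  have "homogeneous (0 + d) ([:[:c:]:] * \<phi> i)" for c i
    by (intro homogeneous_mult homogeneous_const hom)
  then show ?thesis unfolding pencil_def by (intro homogeneous_diff) simp_all
qed

lemma eval2_pencil: "eval2 (pencil y) z = det y (param_map \<phi> z)"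
  unfolding pencil_def eval2_simps det_def param_map_def ..

text \<open>The form \<open>pencil y\<close> of positive degree has a zero, so the curve is the
  whole line.\<close>

lemma H_in_curve_cone:
  assumes "y \<in> H" "y \<noteq> (\<lambda>_. 0)"
  shows "y \<in> curve_cone \<phi>"
proof -
  obtain z where "z \<in> line_cone" "eval2 (pencil y) z = 0"
    using homogeneous_root_dehomogenize[OF homogeneous_pencil] d by (metis less_le_trans zero_less_numeral)
  with det_param_zero[of z y] assms show ?thesis
    unfolding curve_cone_def eval2_pencil by blast
qed

text \<open>A polynomial vanishing on the curve vanishes at \<open>x + \<epsilon> v\<close> for all
  \<open>\<epsilon>\<close> except at most one, where this vector is zero. Hence its first-order
  coefficient is zero.\<close>

lemma H_subset_cone_tangent:
  assumes "x \<in> H" "x \<noteq> (\<lambda>_. 0)" "v \<in> H"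
  shows "v \<in> cone_tangent (curve_cone \<phi>) x"
  unfolding cone_tangent_def mem_Collect_eq
proof (intro allI impI)
  fix F assume F: "\<forall>y\<in>curve_cone \<phi>. eval3 F y = 0"
  let ?y = "\<lambda>\<epsilon> i. x i + \<epsilon> * v i"
  have "?y \<epsilon> \<in> H" for \<epsilon>
  proof -
    have "(\<Sum>i\<in>UNIV. l i * ?y \<epsilon> i) = (\<Sum>i\<in>UNIV. l i * x i) + \<epsilon> * (\<Sum>i\<in>UNIV. l i * v i)"
      by (simp add: distrib_left sum.distrib sum_distrib_left mult.left_commute)
    with assms show ?thesis by (simp add: H_def)
  qed
  then have zero: "eval3 F (?y \<epsilon>) = 0" if "?y \<epsilon> \<noteq> (\<lambda>_. 0)" for \<epsilon>
    using F H_in_curve_cone that by blast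
  obtain j where j: "x j \<noteq> 0" using assms(2) by blast
  have "{\<epsilon>. ?y \<epsilon> = (\<lambda>_. 0)} \<subseteq> {- x j / v j}"
  proof safe
    fix \<epsilon> assume "?y \<epsilon> = (\<lambda>_. 0)"
    then have "x j + \<epsilon> * v j = 0" by (rule fun_cong)
    moreover from this j have "v j \<noteq> 0" by auto
    ultimately show "\<epsilon> = - x j / v j" by (simp add: field_simps eq_neg_iff_add_eq_0 add.commute)
  qed
  then have "finite {\<epsilon>. ?y \<epsilon> = (\<lambda>_. 0)}" using finite_subset by blast
  then have "infinite (- {\<epsilon>. ?y \<epsilon> = (\<lambda>_. 0)})"
    using infinite_UNIV_alg_closed by (simp add: Compl_eq_Diff_UNIV)
  moreover have "- {\<epsilon>. ?y \<epsilon> = (\<lambda>_. 0)} \<subseteq> {\<epsilon>. eval3 F (?y \<epsilon>) = 0}" using zero by blast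
  ultimately have "infinite {\<epsilon>. eval3 F (?y \<epsilon>) = 0}" using finite_subset by blast
  then show "(\<Sum>i\<in>UNIV. eval3 (partial3 i F) x * v i) = 0"
    using first_order_zero[OF first_order_eval3] by blast
qed

text \<open>Otherwise \<open>\<epsilon> \<mapsto> g (p + \<epsilon> u)\<close>, for the form \<open>g\<close> of the pencil vanishing at \<open>p\<close>, is a
  polynomial with the simple root \<open>0\<close> and no other root, hence linear. But its coefficient at
  \<open>\<epsilon>\<^sup>d\<close> is \<open>g u\<close>, which is nonzero.\<close>

lemma det_differential_zero:
  assumes p: "p \<in> line_cone"
    and fibre: "\<And>z. z \<in> line_cone \<Longrightarrow> same_point3 (param_map \<phi> z) (param_map \<phi> p) \<Longrightarrow> same_point2 p z"
  shows "det (param_map \<phi> p) (param_differential \<phi> p u) = 0"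
proof (rule ccontr)
  define x where "x = param_map \<phi> p"
  define g where "g = pencil x"
  define D where "D = det x (param_differential \<phi> p u)"
  assume "\<not> ?thesis"
  then have D: "D \<noteq> 0" by (simp add: D_def x_def)
  have g_root: "same_point2 p z" if "z \<in> line_cone" "eval2 g z = 0" for z
  proof -
    have "x \<noteq> (\<lambda>_. 0)" using no_zero[OF p] by (auto simp: x_def param_map_def fun_eq_iff)
    with that param_in_H show ?thesis
      unfolding g_def eval2_pencil x_def by (intro fibre det_param_zero) auto
  qed
  have fo: "first_order (\<lambda>\<epsilon>. eval2 g (fst p + \<epsilon> * fst u, snd p + \<epsilon> * snd u)) (eval2 g p) D"
  proof -
    let ?f = "\<lambda>i \<epsilon>. eval2 (\<phi> i) (fst p + \<epsilon> * fst u, snd p + \<epsilon> * snd u)"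
    have f: "first_order (?f i) (x i) (param_differential \<phi> p u i)" for i
      using first_order_eval2[of "\<phi> i" "fst p" "fst u" "snd p" "snd u"]
      by (simp add: x_def param_map_def param_differential_def)
    have "first_order (\<lambda>\<epsilon>. x (k + 1) * ?f (k + 2) \<epsilon> + - x (k + 2) * ?f (k + 1) \<epsilon>)
        (x (k + 1) * x (k + 2) + - x (k + 2) * x (k + 1))
        ((x (k + 1) * param_differential \<phi> p u (k + 2) + 0 * x (k + 2)) +
          (- x (k + 2) * param_differential \<phi> p u (k + 1) + 0 * x (k + 1)))"
      by (intro first_order_add first_order_mult first_order_const f)
    then show ?thesis
      by (simp add: g_def eval2_pencil x_def D_def det_def param_map_def)
  qed
  have gp: "eval2 g p = 0" by (simp add: g_def eval2_pencil x_def det_def)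
  obtain q where q: "\<And>\<epsilon>. eval2 g (fst p + \<epsilon> * fst u, snd p + \<epsilon> * snd u) = poly q \<epsilon>"
    "coeff q 0 = 0" "coeff q 1 = D"
    using fo unfolding first_order_def gp by blast
  have hom_g: "homogeneous d g" unfolding g_def by (rule homogeneous_pencil)
  show False
  proof (cases "\<exists>c. u = (c * fst p, c * snd p)")
    case True
    then obtain c where c: "u = (c * fst p, c * snd p)" by blast
    \<comment> \<open>In the direction of \<open>p\<close> itself the point does not change, and
      \<open>g\<close> stays zero by homogeneity.\<close>
    have "poly q \<epsilon> = poly 0 \<epsilon>" for \<epsilon>
    proof -
      have "poly q \<epsilon> = eval2 g ((1 + \<epsilon> * c) * fst p, (1 + \<epsilon> * c) * snd p)"
        by (simp add: c algebra_simps flip: q(1))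
      then show ?thesis unfolding eval2_scale[OF hom_g] by (simp add: gp)
    qed
    then have "q = 0" by (rule poly_ext_alg_closed)
    with q D show False by simp
  next
    case not_parallel: False
    have root: "poly q \<epsilon> \<noteq> 0" if "\<epsilon> \<noteq> 0" for \<epsilon>
    proof
      assume "poly q \<epsilon> = 0"
      let ?z = "(fst p + \<epsilon> * fst u, snd p + \<epsilon> * snd u)"
      have par: "\<exists>c. u = (c * fst p, c * snd p)" if "?z = (c * fst p, c * snd p)" for c
        using that \<open>\<epsilon> \<noteq> 0\<close>
        by (intro exI[of _ "(c - 1) / \<epsilon>"]) (auto simp: prod_eq_iff field_simps)
      have "?z \<in> line_cone" using par[of 0] not_parallel by (auto simp: line_cone_def)
      from g_root[OF this] \<open>poly q \<epsilon> = 0\<close> q(1) par not_parallel show False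
        unfolding same_point2_def by metis
    qed
    obtain r where r: "q = pCons 0 r" using q(2) by (cases q) auto
    \<comment> \<open>A root of \<open>r\<close> would be nonzero, because \<open>r\<close> takes
      the value \<open>D\<close> at 0, and would then be a second root of \<open>q\<close>.\<close>
    have "degree r = 0"
    proof (rule ccontr)
      assume "degree r \<noteq> 0"
      then obtain \<epsilon> where "poly r \<epsilon> = 0" using alg_closed_imp_poly_has_root by blast
      moreover have "poly r 0 = D" using q(3) by (simp add: r poly_0_coeff_0)
      ultimately show False using root[of \<epsilon>] D by (auto simp: r)
    qed
    then have q_lin: "poly q \<epsilon> = \<epsilon> * D" for \<epsilon>
      using q(3) by (auto simp: r elim!: degree_eq_zeroE)
    \<comment> \<open>\<open>q'\<close> is the reversed polynomial of \<open>q\<close>: homogeneity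
      turns \<open>q \<epsilon> = \<epsilon> * D\<close> into \<open>D\<close> times the power
      \<open>d - 1\<close> of \<open>\<delta>\<close>. As \<open>d \<ge> 2\<close>, its value at
      \<open>\<delta> = 0\<close>, which is \<open>g u\<close>, vanishes.\<close>
    obtain q' where q': "\<And>\<delta>. eval2 g (fst u + \<delta> * fst p, snd u + \<delta> * snd p) = poly q' \<delta>"
      using first_order_eval2[of g "fst u" "fst p" "snd u" "snd p"] unfolding first_order_def by blast
    have "poly q' \<delta> = poly (monom D (d - 1)) \<delta>" if "\<delta> \<noteq> 0" for \<delta>
    proof -
      have "poly q' \<delta> = eval2 g (\<delta> * (fst p + inverse \<delta> * fst u), \<delta> * (snd p + inverse \<delta> * snd u))"
      proof -
        have "\<delta> * (a + inverse \<delta> * b) = b + \<delta> * a" for a b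
          using that by (simp add: field_simps)
        then show ?thesis by (simp only: q')
      qed
      also have "\<dots> = \<delta> ^ d * (inverse \<delta> * D)" unfolding eval2_scale[OF hom_g] q(1) q_lin ..
      also have "\<dots> = poly (monom D (d - 1)) \<delta>"
        using that d by (simp add: poly_monom field_simps flip: power_Suc)
      finally show ?thesis .
    qed
    then have "UNIV - {0} \<subseteq> {\<delta>. poly q' \<delta> = poly (monom D (d - 1)) \<delta>}" by blast
    moreover have "infinite (UNIV - {0 :: 'a})" using infinite_UNIV_alg_closed by simp
    ultimately have "q' = monom D (d - 1)" using finite_subset by (intro poly_eqI_infinite) blast
    then have "eval2 g u = 0" using q'[of 0] d by (simp add: poly_monom)
    moreover have "u \<in> line_cone" using not_parallel by (auto simp: line_cone_def prod_eq_iff)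
    ultimately show False
      using g_root not_parallel unfolding same_point2_def by blast
  qed
qed

text \<open>The tangent space at the image \<open>x\<close> of \<open>p\<close> contains all of
  \<open>H\<close>, on which \<open>det x\<close> is not identically zero, whereas
  \<open>det x\<close> kills the image of the differential and the multiples of
  \<open>x\<close>.\<close>

lemma not_smooth_at_injective_point:
  assumes p: "p \<in> line_cone"
    and fibre: "\<And>z. z \<in> line_cone \<Longrightarrow> same_point3 (param_map \<phi> z) (param_map \<phi> p) \<Longrightarrow> same_point2 p z"
  shows "\<not> smooth_onto_image_at \<phi> p"
proof
  assume smooth: "smooth_onto_image_at \<phi> p"
  define x where "x = param_map \<phi> p"
  have x: "x \<in> H" "x \<noteq> (\<lambda>_. 0)"
    using param_in_H no_zero[OF p] by (auto simp: x_def param_map_def fun_eq_iff)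
  \<comment> \<open>The vector of \<open>H\<close> with coordinates \<open>a\<close> and
    \<open>b\<close> at \<open>k + 1\<close> and \<open>k + 2\<close>; the equation of the line
    fixes the coordinate \<open>k\<close>.\<close>
  define w where "w = (\<lambda>a b j. if j = k + 1 then a else if j = k + 2 then b
    else - (l (k + 1) * a + l (k + 2) * b) / l k)"
  have w: "w a b \<in> H" "det x (w a b) = x (k + 1) * b - x (k + 2) * a" for a b
    using lk distinct_3_rotate[of k] distinct_3_rotate[of k, symmetric]
    by (simp_all add: w_def H_iff det_def)
  have "\<exists>a b. det x (w a b) \<noteq> 0"
  proof (rule ccontr)
    assume "\<not> ?thesis"
    then have "x (k + 1) * b - x (k + 2) * a = 0" for a b by (simp add: w(2))
    from this[of 1 0] this[of 0 1] have "x (k + 1) = 0" "x (k + 2) = 0" by simp_all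
    then have "det x y = 0" for y by (simp add: det_def)
    obtain c where c: "\<And>i. w 0 1 i = c * x i"
      using det_zero_parallel[OF x(1) w(1) \<open>det x (w 0 1) = 0\<close> x(2)] by blast
    from c[of "k + 2"] \<open>x (k + 2) = 0\<close> distinct_3_rotate[of k, symmetric] show False by (simp add: w_def)
  qed
  then obtain v where v: "v \<in> H" "det x v \<noteq> 0" using w(1) by blast
  have "v \<in> cone_tangent (curve_cone \<phi>) (param_map \<phi> p)"
    using H_subset_cone_tangent[OF x v(1)] by (simp add: x_def)
  then obtain u c where "v = (\<lambda>i. param_differential \<phi> p u i + c * x i)"
    using smooth unfolding smooth_onto_image_at_def x_def by blast
  then have "det x v = det x (param_differential \<phi> p u)" by (simp add: det_def algebra_simps)
  with v(2) det_differential_zero[OF p fibre] show False by (simp add: x_def)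
qed

end

section \<open>A point whose whole fibre lies in the open set\<close>

lemma param_map_scale:
  assumes "\<And>i. homogeneous d (\<phi> i)"
  shows "param_map \<phi> (c * x, c * y) i = c ^ d * param_map \<phi> (x, y) i"
  unfolding param_map_def by (rule eval2_scale[OF assms])

lemma same_point3_sym:
  assumes "same_point3 x y"
  shows "same_point3 y x"
proof -
  obtain c where "c \<noteq> 0" "\<forall>i. y i = c * x i" using assms unfolding same_point3_def by blast
  then show ?thesis
    unfolding same_point3_def by (intro exI[of _ "inverse c"]) (simp add: mult.assoc[symmetric])
qed

lemma same_point3_trans: "same_point3 x y \<Longrightarrow> same_point3 y z \<Longrightarrow> same_point3 x z"
  unfolding same_point3_def by (metis mult.assoc mult_eq_0_iff)

text \<open>Each of the finitely many points outside the open set excludes at most one point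
  \<open>(1, \<tau>)\<close> of the open set, by injectivity.\<close>

lemma exists_full_fibre:
  fixes \<phi> :: "3 \<Rightarrow> 'a::alg_closed_field poly poly"
  assumes hom: "\<And>i. homogeneous d (\<phi> i)" and e: "homogeneous n e" "dehomogenize e \<noteq> 0"
    and inj: "\<And>p q. p \<in> line_cone \<Longrightarrow> q \<in> line_cone \<Longrightarrow> eval2 e p \<noteq> 0 \<Longrightarrow> eval2 e q \<noteq> 0 \<Longrightarrow>
      same_point3 (param_map \<phi> p) (param_map \<phi> q) \<Longrightarrow> same_point2 p q"
  shows "\<exists>p\<in>line_cone. eval2 e p \<noteq> 0 \<and>
    (\<forall>z\<in>line_cone. same_point3 (param_map \<phi> z) (param_map \<phi> p) \<longrightarrow> same_point2 p z)"
proof -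
  define Z where "Z = {y. poly (dehomogenize e) y = 0}"
  have fin_Z: "finite Z" unfolding Z_def by (rule poly_roots_finite[OF e(2)])
  define B where "B z = {\<tau>. \<tau> \<notin> Z \<and> same_point3 (param_map \<phi> z) (param_map \<phi> (1, \<tau>))}" for z
  have line_1: "(1, \<tau>) \<in> line_cone" for \<tau> :: 'a by (simp add: line_cone_def)
  have Z_iff: "\<tau> \<in> Z \<longleftrightarrow> eval2 e (1, \<tau>) = 0" for \<tau> by (simp add: Z_def poly_dehomogenize)
  have fin_B: "finite (B z)" for z
  proof (cases "B z = {}")
    case False
    then obtain \<sigma> where \<sigma>: "\<sigma> \<in> B z" by blast
    have "\<tau> = \<sigma>" if "\<tau> \<in> B z" for \<tau>
    proof -
      have "same_point3 (param_map \<phi> (1, \<tau>)) (param_map \<phi> (1, \<sigma>))"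
        using \<sigma> that same_point3_sym same_point3_trans unfolding B_def by blast
      then have "same_point2 (1, \<tau>) (1, \<sigma>)"
        using \<sigma> that by (intro inj line_1) (auto simp: B_def Z_iff)
      then show ?thesis by (auto simp: same_point2_def)
    qed
    then have "B z \<subseteq> {\<sigma>}" by blast
    then show ?thesis using finite_subset by blast
  qed simp
  \<comment> \<open>To be avoided are the zeros of \<open>e\<close> and all parameters sharing an
    image with one of them. \<open>(0, 1)\<close> is included whether or not \<open>e\<close>
    vanishes there.\<close>
  have "finite (Z \<union> (\<Union>y\<in>Z. B (1, y)) \<union> B (0, 1))" using fin_Z fin_B by simp
  from ex_new_if_finite[OF infinite_UNIV_alg_closed this]
  obtain \<tau> where \<tau>: "\<tau> \<notin> Z \<union> (\<Union>y\<in>Z. B (1, y)) \<union> B (0, 1)" by (elim exE)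
  show ?thesis
  proof (intro bexI[OF _ line_1[of \<tau>]] conjI ballI impI)
    show e\<tau>: "eval2 e (1, \<tau>) \<noteq> 0" using \<tau> Z_iff by blast
    fix z assume z: "z \<in> line_cone" "same_point3 (param_map \<phi> z) (param_map \<phi> (1, \<tau>))"
    obtain x y where xy: "z = (x, y)" by fastforce
    have "eval2 e z \<noteq> 0"
    proof
      assume ez: "eval2 e z = 0"
      show False
      proof (cases "x = 0")
        case True
        then have "y \<noteq> 0" using z(1) by (auto simp: xy line_cone_def)
        have "param_map \<phi> z i = y ^ d * param_map \<phi> (0, 1) i" for i
          using param_map_scale[where \<phi> = \<phi> and c = y and x = 0 and y = 1 and i = i, OF hom] by (simp add: xy True)
        then have "same_point3 (param_map \<phi> (0, 1)) (param_map \<phi> z)"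
          unfolding same_point3_def using \<open>y \<noteq> 0\<close> by (intro exI[of _ "y ^ d"]) simp
        then have "\<tau> \<in> B (0, 1)" using z(2) \<tau> same_point3_trans unfolding B_def by blast
        with \<tau> show False by blast
      next
        case False
        then have z_eq: "z = (x * 1, x * (y / x))" by (simp add: xy)
        have "param_map \<phi> z i = x ^ d * param_map \<phi> (1, y / x) i" for i
          unfolding z_eq by (rule param_map_scale[OF hom])
        then have "same_point3 (param_map \<phi> (1, y / x)) (param_map \<phi> z)"
          unfolding same_point3_def using False by (intro exI[of _ "x ^ d"]) simp
        then have "\<tau> \<in> B (1, y / x)" using z(2) \<tau> same_point3_trans unfolding B_def by blast
        moreover have "y / x \<in> Z"
          using ez False unfolding z_eq eval2_scale[OF e(1)] Z_iff by simp
        ultimately show False using \<tau> by blast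
      qed
    qed
    then show "same_point2 (1, \<tau>) z"
      using inj[OF line_1 z(1) e\<tau>] same_point3_sym[OF z(2)] by blast
  qed
qed

text \<open>Injectivity and smoothness hold together where the product \<open>f * g\<close> does not
  vanish. A point there with full fibre contradicts
  \<open>not_smooth_at_injective_point\<close>.\<close>

lemma rational_curve_not_in_line:
  fixes \<phi> :: "3 \<Rightarrow> 'a::alg_closed_field poly poly"
  assumes curve: "rational_curve d \<phi>" and d: "d \<ge> 2"
    and no_zero: "\<And>p. p \<in> line_cone \<Longrightarrow> \<exists>i. eval2 (\<phi> i) p \<noteq> 0"
    and rel: "\<And>p. (\<Sum>i\<in>UNIV. l i * eval2 (\<phi> i) p) = 0"
  shows "l k = 0"
proof (rule ccontr)
  assume lk: "l k \<noteq> 0"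
  have hom: "homogeneous d (\<phi> i)" for i using curve unfolding rational_curve_def by blast
  interpret curve_in_line \<phi> d l k
    using hom d no_zero rel lk by unfold_locales
  obtain U where U: "zariski_open U" "U \<noteq> {}"
    "\<forall>p\<in>U. \<forall>q\<in>U. same_point3 (param_map \<phi> p) (param_map \<phi> q) \<longrightarrow> same_point2 p q"
    using curve unfolding rational_curve_def generically_injective_def by blast
  obtain V where V: "zariski_open V" "V \<noteq> {}" "\<forall>p\<in>V. smooth_onto_image_at \<phi> p"
    using curve unfolding rational_curve_def generically_smooth_def by blast
  obtain p m f where f: "homogeneous m f" "eval2 f p \<noteq> 0"
    "\<And>q. q \<in> line_cone \<Longrightarrow> eval2 f q \<noteq> 0 \<Longrightarrow> q \<in> U"
    using zariski_open_basis[OF U(1)] U(2) by (metis ex_in_conv)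
  obtain p' n g where g: "homogeneous n g" "eval2 g p' \<noteq> 0"
    "\<And>q. q \<in> line_cone \<Longrightarrow> eval2 g q \<noteq> 0 \<Longrightarrow> q \<in> V"
    using zariski_open_basis[OF V(1)] V(2) by (metis ex_in_conv)
  have "dehomogenize (f * g) \<noteq> 0"
    using dehomogenize_nonzero[OF f(1,2)] dehomogenize_nonzero[OF g(1,2)]
    by (simp add: dehomogenize_mult)
  moreover have "same_point2 p q"
    if "p \<in> line_cone" "q \<in> line_cone" "eval2 (f * g) p \<noteq> 0" "eval2 (f * g) q \<noteq> 0"
      "same_point3 (param_map \<phi> p) (param_map \<phi> q)" for p q
    using that U(3) f(3) by (simp add: eval2_mult)
  ultimately have "\<exists>q\<in>line_cone. eval2 (f * g) q \<noteq> 0 \<and>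
      (\<forall>z\<in>line_cone. same_point3 (param_map \<phi> z) (param_map \<phi> q) \<longrightarrow> same_point2 q z)"
    by (rule exists_full_fibre[OF hom homogeneous_mult[OF f(1) g(1)]])
  then obtain q where q: "q \<in> line_cone" "eval2 (f * g) q \<noteq> 0"
    "\<And>z. z \<in> line_cone \<Longrightarrow> same_point3 (param_map \<phi> z) (param_map \<phi> q) \<Longrightarrow> same_point2 q z"
    by blast
  have "q \<in> V" using q(1,2) g(3) by (simp add: eval2_mult)
  with V(3) not_smooth_at_injective_point[OF q(1,3)] show False by blast
qed

theorem theorem2p2p2:
  fixes \<phi> :: "3 \<Rightarrow> 'a::alg_closed_field poly poly" and a b d :: nat
  assumes "d \<ge> 2"
    and "rational_curve d \<phi>"
    and "splitting_type d \<phi> a b"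
  shows "b + d - 1 = saturation_degree (ideal_generated (range \<phi>)) \<and>
         saturation_degree (ideal_generated (range \<phi>)) \<le> 2 * d - 2"
proof -
  have hom: "\<And>i. homogeneous d (\<phi> i)" and coprime: "\<forall>g. (\<forall>i. g dvd \<phi> i) \<longrightarrow> is_unit g"
    using assms(2) unfolding rational_curve_def by blast+
  have no_zero: "\<exists>i. eval2 (\<phi> i) p \<noteq> 0" if "p \<in> line_cone" for p
    using coprime_forms_no_common_zero[OF hom _ coprime that] assms(1) by simp
  have splits: "a \<le> b" "a + b = d" "b > 0"
    using assms(1,3) unfolding splitting_type_def by auto
  obtain \<Phi> where \<Phi>:
    "sheaf_isomorphism (pullback_twisted_cotangent \<phi>) (twist_sum (- int a) (- int b)) \<Phi>"
    using assms(3) unfolding splitting_type_def sheaf_isomorphic_def by blast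
  interpret split_pullback \<phi> d a b \<Phi>
    using hom no_zero \<Phi> splits by unfold_locales
  obtain P Q where P: "\<And>k. homogeneous a (P k)" and Q: "\<And>k. homogeneous b (Q k)"
    and syz: "(\<Sum>k\<in>UNIV. P k * \<phi> k) = 0" "(\<Sum>k\<in>UNIV. Q k * \<phi> k) = 0"
    and indep: "\<forall>\<alpha> \<beta>. (\<forall>k. \<alpha> * eval2 (P k) (0, 1) + \<beta> * eval2 (Q k) (0, 1) = 0)
      \<longrightarrow> \<alpha> = 0 \<and> \<beta> = 0"
    using independent_syzygies by blast
  have sat: "saturation_degree (ideal_generated (range \<phi>)) = b + d - 1"
    by (rule saturation_degree_of_syzygies[OF hom P Q splits(2,1,3) syz no_zero])
      (auto intro!: indep[rule_format])
  \<comment> \<open>This is the inequality, because \<open>b + d - 1 = 2 * d - 1 - a\<close>. For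
    \<open>a = 0\<close> the syzygy \<open>P\<close> is a constant vector \<open>l\<close>, an
    equation of a line containing the curve; then \<open>l = 0\<close>, against
    independence.\<close>
  have "a \<noteq> 0"
  proof
    assume "a = 0"
    define l where "l k = eval2 (P k) (0, 1)" for k
    have P_const: "eval2 (P k) p = l k" for k p
    proof -
      have "homogeneous 0 (P k)" using P \<open>a = 0\<close> by simp
      then have "P k = homogenize 0 (dehomogenize (P k))" using homogeneous_iff_homogenize by blast
      then have "eval2 (P k) (x, y) = coeff (dehomogenize (P k)) 0" for x y
        using eval2_homogenize[of 0 "dehomogenize (P k)" x y] by simp
      then show ?thesis unfolding l_def by (metis surj_pair)
    qed
    have "(\<Sum>k\<in>UNIV. l k * eval2 (\<phi> k) p) = 0" for p
      using arg_cong[OF syz(1), of "\<lambda>f. eval2 f p"] by (simp add: eval2_simps P_const)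
    then have "l k = 0" for k
      using rational_curve_not_in_line[OF assms(2,1) no_zero] by blast
    with indep[rule_format, of 1 0] show False by (simp add: l_def)
  qed
  with sat splits show ?thesis by auto
qed

end
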